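(* Let $\rho\ge 0$, and fix a horizon $1\le t<\infty$ and a controller order $1\le v\le t$ such that $$\delta:=\frac{\beta^{\le t,v}}{\alpha^{\le t,v}}\in[0,1).$$ If $$\lambda>\frac{\delta}{1-\delta}\Big(\big\|[\mathfrak L^{\le t,v}_{\mathcal A_*}]^\dagger(W^{\le t}+T^{\le t,v})\big\|_{\rm act}^\star+\rho\,\|U_*^{\le v}\|_{\rm act}^\star\Big)+\frac{1}{1-\delta}\big\|[\mathfrak L^{\le t,v}_{\mathcal A_*^\perp}]^\dagger(W^{\le t}+T^{\le t,v})\big\|_{\rm act}^\star ,$$ then the solution $\hat U$ of $$\underset{U\in\mathcal{RH}_\infty^{\le v}\cap\mathcal A_*}{\text{minimize}}\ \ \|Y^{\le t}-\mathfrak L^{\le t,v}(U)\|_{\mathcal H_2}^2+\rho\|U\|_{\mathcal H_2}^2+2\lambda\|U\|_{\rm act}$$ is the unique optimal solution of $$\underset{U\in\mathcal{RH}_\infty^{\le v}}{\text{minimize}}\ \ \|Y^{\le t}-\mathfrak L^{\le t,v}(U)\|_{\mathcal H_2}^2+\rho\|U\|_{\mathcal H_2}^2+2\lambda\|U\|_{\rm act},$$ and the row support of $\hat U$ is contained in the row support of $U_*$. Further, if $\mathcal A\in\mathscr M_*$ and $$\|(U_*^{\le v})_{\mathcal A}\|_{\mathcal H_2}>\frac{1}{\alpha^{\le t,v}}\Big(\lambda+\big\|[\mathfrak L^{\le t,v}_{\mathcal A_*}]^\dagger(W^{\le t}+T^{\le t,v})\big\|_{\rm act}^\star+\rho\,\|U_*^{\le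 v}\|_{\rm act}^\star\Big),$$ then $\hat U_{\mathcal A}\neq 0$.
   Context: Spaces. Discrete time. $\mathcal{RH}_\infty$ is the space of real rational proper stable transfer matrices $G=\sum_{i\ge0}z^{-i}G^{(i)}$, with the $\mathcal H_2$ inner product $\langle G,H\rangle=\sum_i \mathrm{Tr}(G^{(i)\top}H^{(i)})$ and norm $\|\cdot\|_{\mathcal H_2}$. $\mathcal{RH}_\infty^{\le t}=\{G=\sum_{i=0}^t z^{-i}G^{(i)}\}$, and $G^{\le t}=\sum_{i=0}^t z^{-i}G^{(i)}$ is the truncation of $G$. $\dagger$ denotes adjoint. System. $A,B_1,B_2,C_1$ are real matrices with $A$ square, $B_1$ invertible, and $B_2$ having $n_a$ columns (one per actuator); the system is open-loop stable, or the problem is over a finite horizon (only finitely many impulse response coefficients enter below). $Y=C_1(zI-A)^{-1}B_1$ is the state component of the open loop response, and $\mathfrak L(U)=\frac1z C_1(zI-A)^{-1}B_2\,U$ is the map from the Youla parameter $U\in\mathcal{RH}_\infty^{n_a\times n_s}$ ($n_s$ is the number of columns of $B_1$) to the state component. $\mathfrak L^{\le t,v}:\mathcal{RH}_\infty^{\le v}\to\mathcal{RH}_\infty^{\le t}$ is $U\mapsto(\mathfrak L(U))^{\le t}$. For a subspace $\mathcal S$, $\mathfrak L^{\le t,v}_{\mathcal S}$ is the restriction of $\mathfrak L^{\le t,v}$ to $\mathcal{RH}_\infty^{\le v}\cap\mathcal S$, and $G_{\mathcal S}$ is the projection of $G$ onto $\mathcal S$. Actuator structure. For $i=1,\dots,n_a$,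 $\mathcal A_i=\{e_iV: V\in\mathcal{RH}_\infty^{1\times n_s}\}$ is the subspace of Youla parameters supported on row $i$; $\mathscr M_{\rm act}=\{\mathcal A_1,\dots,\mathcal A_{n_a}\}$. $\|U\|_{\rm act}=\sum_{i=1}^{n_a}\|e_i^\top U\|_{\mathcal H_2}$, with dual norm $\|U\|_{\rm act}^\star=\max_{\mathcal A\in\mathscr M_{\rm act}}\|U_{\mathcal A}\|_{\mathcal H_2}$. Desired controller. $U_*\in\mathcal{RH}_\infty^{n_a\times n_s}$ is a fixed nonzero Youla parameter. Its row support is the set of indices of its nonzero rows. $\mathscr M_*=\{\mathcal A\in\mathscr M_{\rm act}:(U_* )_{\mathcal A}\ne0\}$; $\mathcal A_*$ is the subspace of all $U$ whose $i$th row is zero whenever the $i$th row of $U_*$ is zero; $\mathcal A_*^\perp$ is its orthogonal complement (those $U$ supported on the rows where $U_*$ is zero). $W^{\le t}=Y^{\le t}-\mathfrak L^{\le t,t}(U_*^{\le t})$ and $T^{\le t,v}=\mathfrak L^{\le t,t}(U_*^{\le t}-U_*^{\le v})$. Restricted gains. $$\alpha^{\le t,v}=\min\big\{\|([\mathfrak L^{\le t,v}_{\mathcal A_*}]^\dagger\mathfrak L^{\le t,v}_{\mathcal A_*}+\rho I)(\Delta)\|_{\rm act}^\star:\ \|\Delta\|_{\rm act}^\star=1,\ \Delta\in\mathcal A_*\cap\mathcal{RH}_\infty^{\le v}\big\},$$ $$\beta^{\le t,v}=\max\big\{\|[\mathfrak L^{\le t,v}_{\mathcal A_*^\perp}]^\dagger\mathfrak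 L^{\le t,v}_{\mathcal A_*}(\Delta)\|_{\rm act}^\star:\ \|\Delta\|_{\rm act}^\star\le1,\ \Delta\in\mathcal A_*\cap\mathcal{RH}_\infty^{\le v}\big\}.$$ The condition $\delta\in[0,1)$ includes $\alpha^{\le t,v}>0$. *)

theory Defs
  imports "HOL-Analysis.Analysis" "HOL-Computational_Algebra.Computational_Algebra"
begin

text \<open>
  A transfer matrix with \<open>m\<close> rows and \<open>k\<close> columns is an element of \<open>real fls ^ 'k ^ 'm\<close>: each
  entry is identified with its Laurent expansion at infinity. The formal variable \<open>fls_X\<close> is the
  delay operator \<open>1 / z\<close>, so \<open>z\<close> itself is \<open>fls_X_inv\<close>, and the coefficient of \<open>fls_X\<close> to the
  power \<open>i\<close> is the \<open>i\<close>-th impulse response coefficient.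
\<close>

type_synonym ('m, 'k) tf = "real fls ^ 'k ^ 'm"

abbreviation zvar :: "real fls" where
  "zvar \<equiv> fls_X_inv"

definition cmat :: "real ^ 'k ^ 'm \<Rightarrow> ('m::finite, 'k::finite) tf" where
  "cmat M = map_matrix fls_const M"

definition tf_scale :: "real \<Rightarrow> ('m, 'k) tf \<Rightarrow> ('m::finite, 'k::finite) tf" where
  "tf_scale c G = map_matrix (\<lambda>g. fls_const c * g) G"

definition imp :: "('m, 'k) tf \<Rightarrow> nat \<Rightarrow> real ^ 'k::finite ^ 'm::finite" where
  "imp G i = map_matrix (\<lambda>g. fls_nth g (int i)) G"


section \<open>Spaces of transfer matrices\<close>

definition poly_at_z :: "real poly \<Rightarrow> real fls" where
  "poly_at_z p = poly (map_poly fls_const p) zvar"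

text \<open>Real rational, proper (\<open>degree p \<le> degree q\<close>), with all poles in the open unit disc.\<close>

definition stable_rational :: "real fls \<Rightarrow> bool" where
  "stable_rational g \<longleftrightarrow> (\<exists>p q. q \<noteq> 0 \<and> degree p \<le> degree q \<and>
     (\<forall>x::complex. poly (map_poly of_real q) x = 0 \<longrightarrow> norm x < 1) \<and>
     g = poly_at_z p / poly_at_z q)"

definition RHinf :: "('m::finite, 'k::finite) tf set" where
  "RHinf = {G. \<forall>a b. stable_rational (G $ a $ b)}"

definition fir :: "nat \<Rightarrow> (nat \<Rightarrow> real ^ 'k ^ 'm) \<Rightarrow> ('m::finite, 'k::finite) tf" where
  "fir t g = (\<Sum>i\<le>t. mat (inverse zvar ^ i) ** cmat (g i))"

definition RHinf_le :: "nat \<Rightarrow> ('m::finite, 'k::finite) tf set" where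
  "RHinf_le t = range (fir t)"

definition trunc :: "nat \<Rightarrow> ('m, 'k) tf \<Rightarrow> ('m::finite, 'k::finite) tf" where
  "trunc t G = fir t (imp G)"

text \<open>The inner product and norm are only meaningful on \<^const>\<open>RHinf\<close>, where the series converges
  absolutely; arguments with a nonzero coefficient at a positive power of \<open>z\<close> are not proper.\<close>

definition h2_inner :: "('m, 'k) tf \<Rightarrow> ('m::finite, 'k::finite) tf \<Rightarrow> real" where
  "h2_inner G H = (\<Sum>i. trace (transpose (imp G i) ** imp H i))"

definition h2_norm :: "('m::finite, 'k::finite) tf \<Rightarrow> real" where
  "h2_norm G = sqrt (h2_inner G G)"

definition h2_proj :: "('m, 'k) tf set \<Rightarrow> ('m, 'k) tf \<Rightarrow> ('m::finite, 'k::finite) tf" where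
  "h2_proj S G = (THE P. P \<in> S \<and> (\<forall>H\<in>S. h2_inner (G - P) H = 0))"

definition h2_orth :: "('m, 'k) tf set \<Rightarrow> ('m::finite, 'k::finite) tf set" where
  "h2_orth S = {U \<in> RHinf. \<forall>H\<in>S. h2_inner U H = 0}"

text \<open>Adjoint of a linear map whose domain is the subspace \<open>D\<close>; it takes values in \<open>D\<close>.\<close>

definition h2_adjoint_on ::
  "('m, 'k) tf set \<Rightarrow> (('m, 'k) tf \<Rightarrow> ('n, 'l) tf) \<Rightarrow> ('n::finite, 'l::finite) tf \<Rightarrow> ('m::finite, 'k::finite) tf"
where
  "h2_adjoint_on D f G = (THE U. U \<in> D \<and> (\<forall>H\<in>D. h2_inner (f H) G = h2_inner H U))"


section \<open>The system\<close>

definition resolvent :: "real ^ 'n ^ 'n \<Rightarrow> ('n::finite, 'n) tf" where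
  "resolvent A = matrix_inv (mat zvar - cmat A)"

definition open_loop ::
  "real ^ 'n ^ 'n \<Rightarrow> real ^ 's ^ 'n \<Rightarrow> real ^ 'n ^ 'p \<Rightarrow> ('p::finite, 's::finite) tf"
where
  "open_loop A B1 C1 = cmat C1 ** resolvent A ** cmat B1"

definition youla_map ::
  "real ^ 'n ^ 'n \<Rightarrow> real ^ 'a ^ 'n \<Rightarrow> real ^ 'n ^ 'p \<Rightarrow> ('a, 's) tf \<Rightarrow> ('p::finite, 's::finite) tf"
where
  "youla_map A B2 C1 U = mat (1 / zvar) ** cmat C1 ** resolvent A ** cmat B2 ** U"

text \<open>The map \<open>L\<close> from controllers of order at most \<open>v\<close> to responses up to time \<open>t\<close>. The order
  \<open>v\<close> and a subspace \<open>S\<close> only restrict the domain, which matters for the adjoint.\<close>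

definition Lmap ::
  "real ^ 'n ^ 'n \<Rightarrow> real ^ 'a ^ 'n \<Rightarrow> real ^ 'n ^ 'p \<Rightarrow> nat \<Rightarrow> ('a, 's) tf \<Rightarrow> ('p::finite, 's::finite) tf"
where
  "Lmap A B2 C1 t U = trunc t (youla_map A B2 C1 U)"

definition Ladj ::
  "real ^ 'n ^ 'n \<Rightarrow> real ^ 'a ^ 'n \<Rightarrow> real ^ 'n ^ 'p \<Rightarrow> nat \<Rightarrow> nat \<Rightarrow> ('a, 's) tf set
    \<Rightarrow> ('p::finite, 's::finite) tf \<Rightarrow> ('a::finite, 's) tf"
where
  "Ladj A B2 C1 t v S G = h2_adjoint_on (RHinf_le v \<inter> S) (Lmap A B2 C1 t) G"


section \<open>Actuators\<close>

definition act_space :: "'a \<Rightarrow> ('a::finite, 's::finite) tf set" where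
  "act_space i = {columnvector (axis i 1) ** V | V :: (1, 's) tf. V \<in> RHinf}"

definition M_act :: "('a::finite, 's::finite) tf set set" where
  "M_act = range act_space"

definition act_norm :: "('a::finite, 's::finite) tf \<Rightarrow> real" where
  "act_norm U = (\<Sum>i\<in>UNIV. h2_norm (rowvector (axis i 1) ** U :: (1, 's) tf))"

definition act_dual_norm :: "('a::finite, 's::finite) tf \<Rightarrow> real" where
  "act_dual_norm U = Max ((\<lambda>S. h2_norm (h2_proj S U)) ` M_act)"

definition row_support :: "('a::finite, 's::finite) tf \<Rightarrow> 'a set" where
  "row_support U = {i. row i U \<noteq> 0}"

definition M_star :: "('a, 's) tf \<Rightarrow> ('a::finite, 's::finite) tf set set" where
  "M_star Us = {S \<in> M_act. h2_proj S Us \<noteq> 0}"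

definition A_star :: "('a, 's) tf \<Rightarrow> ('a::finite, 's::finite) tf set" where
  "A_star Us = {U \<in> RHinf. \<forall>i. row i Us = 0 \<longrightarrow> row i U = 0}"


section \<open>Residuals, restricted gains and the regularized problem\<close>

definition W_res ::
  "real ^ 'n ^ 'n \<Rightarrow> real ^ 's ^ 'n \<Rightarrow> real ^ 'a ^ 'n \<Rightarrow> real ^ 'n ^ 'p \<Rightarrow> ('a, 's) tf \<Rightarrow> nat
    \<Rightarrow> ('p::finite, 's::finite) tf"
where
  "W_res A B1 B2 C1 Us t = trunc t (open_loop A B1 C1) - Lmap A B2 C1 t (trunc t Us)"

definition T_res ::
  "real ^ 'n ^ 'n \<Rightarrow> real ^ 'a ^ 'n \<Rightarrow> real ^ 'n ^ 'p \<Rightarrow> ('a, 's) tf \<Rightarrow> nat \<Rightarrow> nat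
    \<Rightarrow> ('p::finite, 's::finite) tf"
where
  "T_res A B2 C1 Us t v = Lmap A B2 C1 t (trunc t Us - trunc v Us)"

text \<open>The infimum and supremum below range over continuous images of nonempty compact sets
  (for \<open>Us \<noteq> 0\<close>), so they are a minimum and a maximum.\<close>

definition alpha_gain ::
  "real ^ 'n ^ 'n \<Rightarrow> real ^ 'a ^ 'n \<Rightarrow> real ^ 'n ^ 'p \<Rightarrow> real \<Rightarrow> ('a::finite, 's::finite) tf \<Rightarrow> nat \<Rightarrow> nat \<Rightarrow> real"
where
  "alpha_gain A B2 C1 \<rho> Us t v =
     Inf {act_dual_norm (Ladj A B2 C1 t v (A_star Us) (Lmap A B2 C1 t \<Delta>) + tf_scale \<rho> \<Delta>) | \<Delta>.
            act_dual_norm \<Delta> = 1 \<and> \<Delta> \<in> A_star Us \<inter> RHinf_le v}"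

definition beta_gain ::
  "real ^ 'n ^ 'n \<Rightarrow> real ^ 'a ^ 'n \<Rightarrow> real ^ 'n ^ 'p \<Rightarrow> ('a::finite, 's::finite) tf \<Rightarrow> nat \<Rightarrow> nat \<Rightarrow> real"
where
  "beta_gain A B2 C1 Us t v =
     Sup {act_dual_norm (Ladj A B2 C1 t v (h2_orth (A_star Us)) (Lmap A B2 C1 t \<Delta>)) | \<Delta>.
            act_dual_norm \<Delta> \<le> 1 \<and> \<Delta> \<in> A_star Us \<inter> RHinf_le v}"

definition objective ::
  "real ^ 'n ^ 'n \<Rightarrow> real ^ 's ^ 'n \<Rightarrow> real ^ 'a ^ 'n \<Rightarrow> real ^ 'n ^ 'p \<Rightarrow> real \<Rightarrow> real \<Rightarrow> nat
    \<Rightarrow> ('a::finite, 's::finite) tf \<Rightarrow> real"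
where
  "objective A B1 B2 C1 \<rho> lam t U =
     (h2_norm (trunc t (open_loop A B1 C1) - Lmap A B2 C1 t U))\<^sup>2
       + \<rho> * (h2_norm U)\<^sup>2 + 2 * lam * act_norm U"

definition minimizers :: "('b \<Rightarrow> real) \<Rightarrow> 'b set \<Rightarrow> 'b set" where
  "minimizers f S = {x. is_arg_min f (\<lambda>y. y \<in> S) x}"

end

theory Submission
  imports Defs
begin

text \<open>
  Set \<open>D = U\<^sub>* - U\<close> for the restricted minimizer \<open>U\<close> (with \<open>U\<^sub>*\<close> truncated to order \<open>v\<close>) and
  \<open>R = W + T = Y - L U\<^sub>*\<close>. By stationarity, \<open>g = L\<^sup>\<dagger> (Y - L U) - \<rho> U = L\<^sup>\<dagger> (R + L D) - \<rho> U\<close> has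
  dual norm at most \<open>\<lambda>\<close> on the active rows. Solving for \<open>(L\<^sup>\<dagger> L + \<rho> I) D\<close> there gives
  \<open>\<alpha> \<parallel>D\<parallel> \<le> \<lambda> + \<parallel>L\<^sup>\<dagger> R\<parallel> + \<rho> \<parallel>U\<^sub>*\<parallel>\<close>; on the inactive rows \<open>g = L\<^sup>\<dagger> R + L\<^sup>\<dagger> L D\<close> then has dual norm at
  most \<open>\<parallel>L\<^sup>\<dagger> R\<parallel> + \<beta> \<parallel>D\<parallel> < \<lambda>\<close>. The strict inequality makes \<open>U\<close> the unique unrestricted minimizer,
  and a row of \<open>U\<close> cannot vanish where \<open>U\<^sub>*\<close> exceeds the bound on \<open>\<parallel>D\<parallel>\<close>.
\<close>

no_notation fps_nth (infixl "$" 75)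

section \<open>Impulse response coefficients\<close>

lemma imp_nth: "imp G i $ a $ b = fls_nth (G $ a $ b) (int i)"
  by (simp add: imp_def map_matrix_def)

lemma imp_add: "imp (G + H) i = imp G i + imp H i"
  by (simp add: vec_eq_iff imp_nth)

lemma imp_diff: "imp (G - H) i = imp G i - imp H i"
  by (simp add: vec_eq_iff imp_nth)

lemma imp_zero [simp]: "imp 0 i = 0"
  by (simp add: vec_eq_iff imp_nth)

lemma tf_scale_nth: "tf_scale c G $ a $ b = fls_const c * G $ a $ b"
  by (simp add: tf_scale_def map_matrix_def)

lemma imp_scale: "imp (tf_scale c G) i = c *\<^sub>R imp G i"
  by (simp add: vec_eq_iff imp_nth tf_scale_nth)

lemma tf_scale_minus_one: "tf_scale (- 1) G = - G"
  by (simp add: vec_eq_iff tf_scale_nth fls_eq_iff)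

lemma tf_scale_scale: "tf_scale c (tf_scale d G) = tf_scale (c * d) G"
  by (simp add: vec_eq_iff tf_scale_nth fls_eq_iff)

lemma tf_scale_zero [simp]: "tf_scale c 0 = 0"
  by (simp add: vec_eq_iff tf_scale_nth)

lemma tf_scale_add: "tf_scale c (G + H) = tf_scale c G + tf_scale c H"
  by (simp add: vec_eq_iff tf_scale_nth distrib_left)

lemma matrix_mult_tf_scale: "M ** tf_scale c U = tf_scale c (M ** U)"
  by (simp add: vec_eq_iff matrix_matrix_mult_def tf_scale_nth sum_distrib_left mult.left_commute)

text \<open>The monomials z^-i M span the finite impulse responses, so a linear map on these is
  known from its values on monomials.\<close>

definition monotf :: "nat \<Rightarrow> real ^ 'k ^ 'm \<Rightarrow> ('m::finite, 'k::finite) tf" where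
  "monotf i M = mat (inverse zvar ^ i) ** cmat M"

lemma monotf_entry: "monotf i M $ a $ b = fls_shift (- int i) (fls_const (M $ a $ b))"
proof -
  have "monotf i M $ a $ b
      = (\<Sum>k\<in>UNIV. (if a = k then inverse fls_X_inv ^ i else 0) * fls_const (M $ k $ b))"
    by (simp add: monotf_def matrix_matrix_mult_def mat_def cmat_def map_matrix_def)
  also have "\<dots> = (\<Sum>k\<in>UNIV. if k = a then fls_X ^ i * fls_const (M $ k $ b) else 0)"
    by (intro sum.cong) (auto simp: fls_inverse_X_inv)
  finally show ?thesis
    by (simp add: fls_X_power_times_conv_shift)
qed

lemma monotf_nth: "fls_nth (monotf i M $ a $ b) n = (if n = int i then M $ a $ b else 0)"
  by (auto simp: monotf_entry)

lemma monotf_add: "monotf i (M + M') = monotf i M + monotf i M'"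
  by (auto simp: vec_eq_iff fls_eq_iff monotf_nth)

lemma monotf_scale: "monotf i (c *\<^sub>R M) = tf_scale c (monotf i M)"
  by (auto simp: vec_eq_iff fls_eq_iff monotf_nth tf_scale_nth)

lemma fir_eq_sum_monotf: "fir N g = (\<Sum>i\<le>N. monotf i (g i))"
  by (simp add: fir_def monotf_def)

lemma fls_nth_sum_entry:
  "finite I \<Longrightarrow> fls_nth ((\<Sum>i\<in>I. f i) $ a $ b) n = (\<Sum>i\<in>I. fls_nth (f i $ a $ b) n)"
  by (induction rule: finite_induct) auto

lemma fir_nth:
  "fls_nth (fir N g $ a $ b) n = (if 0 \<le> n \<and> n \<le> int N then g (nat n) $ a $ b else 0)"
proof -
  have "fls_nth (fir N g $ a $ b) n = (\<Sum>i\<le>N. if i = nat n \<and> 0 \<le> n then g i $ a $ b else 0)"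
    unfolding fir_eq_sum_monotf
    by (subst fls_nth_sum_entry) (auto simp: monotf_nth intro!: sum.cong)
  also have "\<dots> = (if 0 \<le> n \<and> n \<le> int N then g (nat n) $ a $ b else 0)"
    by (cases "0 \<le> n") auto
  finally show ?thesis .
qed

lemma imp_fir: "imp (fir N g) i = (if i \<le> N then g i else 0)"
  by (auto simp: vec_eq_iff imp_nth fir_nth)

text \<open>Vanishing coefficients make the closure properties entrywise checks. Exponents are
  integers here, so the negative ones, which \<open>imp\<close> does not see, are ruled out as
  well.\<close>

lemma RHinf_le_iff:
  "G \<in> RHinf_le N \<longleftrightarrow> (\<forall>a b n. n < 0 \<or> n > int N \<longrightarrow> fls_nth (G $ a $ b) n = 0)"
proof
  assume "G \<in> RHinf_le N"
  then show "\<forall>a b n. n < 0 \<or> n > int N \<longrightarrow> fls_nth (G $ a $ b) n = 0"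
    by (auto simp: RHinf_le_def fir_nth)
next
  assume *: "\<forall>a b n. n < 0 \<or> n > int N \<longrightarrow> fls_nth (G $ a $ b) n = 0"
  have "G = fir N (imp G)"
    using * by (auto simp: vec_eq_iff fls_eq_iff fir_nth imp_nth not_le)
  then show "G \<in> RHinf_le N"
    unfolding RHinf_le_def by blast
qed

lemma fir_imp: "G \<in> RHinf_le N \<Longrightarrow> fir N (imp G) = G"
  by (auto simp: vec_eq_iff fls_eq_iff fir_nth imp_nth RHinf_le_iff not_le)

lemma imp_beyond: "G \<in> RHinf_le N \<Longrightarrow> N < i \<Longrightarrow> imp G i = 0"
  by (auto simp: vec_eq_iff imp_nth RHinf_le_iff)

lemma RHinf_le_eqI:
  assumes "G \<in> RHinf_le N" "H \<in> RHinf_le N" "\<And>i. i \<le> N \<Longrightarrow> imp G i = imp H i"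
  shows "G = H"
proof -
  have "fir N (imp G) = fir N (imp H)"
    unfolding fir_def using assms(3) by simp
  then show ?thesis using assms by (simp add: fir_imp)
qed

lemma RHinf_le_fir [simp]: "fir N g \<in> RHinf_le N"
  by (simp add: RHinf_le_def)

lemma RHinf_le_trunc [simp]: "trunc N G \<in> RHinf_le N"
  by (simp add: trunc_def)

lemma RHinf_le_monotf: "monotf i M \<in> RHinf_le i"
  by (auto simp: RHinf_le_iff monotf_nth)

lemma RHinf_le_mono: "G \<in> RHinf_le M \<Longrightarrow> M \<le> N \<Longrightarrow> G \<in> RHinf_le N"
  by (auto simp: RHinf_le_iff)

lemma RHinf_le_monotf_le: "i \<le> N \<Longrightarrow> monotf i M \<in> RHinf_le N"
  by (rule RHinf_le_mono[OF RHinf_le_monotf])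

lemma RHinf_le_zero [simp]: "0 \<in> RHinf_le N"
  by (auto simp: RHinf_le_iff)

lemma RHinf_le_add [intro]: "G \<in> RHinf_le N \<Longrightarrow> H \<in> RHinf_le N \<Longrightarrow> G + H \<in> RHinf_le N"
  by (auto simp: RHinf_le_iff)

lemma RHinf_le_diff [intro]: "G \<in> RHinf_le N \<Longrightarrow> H \<in> RHinf_le N \<Longrightarrow> G - H \<in> RHinf_le N"
  by (auto simp: RHinf_le_iff)

lemma RHinf_le_scale [intro]: "G \<in> RHinf_le N \<Longrightarrow> tf_scale c G \<in> RHinf_le N"
  by (auto simp: RHinf_le_iff tf_scale_nth)

lemma RHinf_le_sum: "(\<And>i. i \<in> I \<Longrightarrow> f i \<in> RHinf_le N) \<Longrightarrow> sum f I \<in> RHinf_le N"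
  by (induction I rule: infinite_finite_induct) auto

lemma imp_trunc: "imp (trunc N G) i = (if i \<le> N then imp G i else 0)"
  by (simp add: trunc_def imp_fir)

lemma trunc_add: "trunc N (G + H) = trunc N G + trunc N H"
  by (auto intro!: RHinf_le_eqI[of _ N] simp: imp_trunc imp_add)

lemma trunc_scale: "trunc N (tf_scale c G) = tf_scale c (trunc N G)"
  by (auto intro!: RHinf_le_eqI[of _ N] simp: imp_trunc imp_scale)


section \<open>Finite impulse responses are stable, stable responses are proper\<close>

text \<open>As z is the inverse of the delay, a polynomial in z lives on nonpositive exponents;
  \<open>pCons\<close> shifts it by one.\<close>

lemma poly_at_z_nth: "fls_nth (poly_at_z p) n = (if n \<le> 0 then coeff p (nat (- n)) else 0)"
proof (induction p arbitrary: n)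
  case 0
  then show ?case by (simp add: poly_at_z_def)
next
  case (pCons c p)
  have "poly_at_z (pCons c p) = fls_const c + fls_shift 1 (poly_at_z p)"
    by (simp add: poly_at_z_def map_poly_pCons fls_X_inv_times_conv_shift)
  moreover have "nat (- n) = Suc (nat (- (n + 1)))" if "n < 0"
    using that by simp
  ultimately show ?case
    using pCons.IH[of "n + 1"] by (cases "n = 0"; cases "n < 0") auto
qed

lemma poly_at_z_0: "p \<noteq> 0 \<Longrightarrow> poly_at_z p \<noteq> 0"
  using poly_at_z_nth[of p "- int (degree p)"] by auto

lemma fls_subdegree_poly_at_z: "p \<noteq> 0 \<Longrightarrow> fls_subdegree (poly_at_z p) = - int (degree p)"
  by (rule fls_subdegree_eqI) (auto simp: poly_at_z_nth intro!: coeff_eq_0)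

text \<open>Evaluation at z turns the degree into minus the subdegree, so a nonzero quotient starts
  at exponent \<open>degree q - degree p\<close>, which is nonnegative.\<close>

lemma stable_rational_proper:
  assumes "stable_rational g" "n < 0"
  shows "fls_nth g n = 0"
proof -
  obtain p q where pq: "q \<noteq> 0" "degree p \<le> degree q" "g = poly_at_z p / poly_at_z q"
    using assms(1) unfolding stable_rational_def by blast
  show ?thesis
  proof (cases "p = 0")
    case True
    then show ?thesis using pq by (simp add: poly_at_z_def)
  next
    case False
    then have "fls_subdegree g = int (degree q) - int (degree p)"
      unfolding pq(3) using pq(1)
      by (subst fls_divide_subdegree) (simp_all add: poly_at_z_0 fls_subdegree_poly_at_z)
    then show ?thesis
      using pq(2) assms(2) by (intro fls_eq0_below_subdegree) simp
  qed
qed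

text \<open>Multiplying by z^N leaves a polynomial, so g is a polynomial over z^N, whose only
  possible pole is the origin.\<close>

lemma stable_rational_fir:
  assumes "\<And>n. n < 0 \<or> n > int N \<Longrightarrow> fls_nth g n = 0"
  shows "stable_rational g"
proof -
  \<comment> \<open>The exponent N - i reverses the order of coefficients: z^-i times z^N is
    z^(N-i).\<close>
  define p where "p = (\<Sum>i\<le>N. monom (fls_nth g (int i)) (N - i))"
  define q where "q = (monom 1 N :: real poly)"
  have coeff_p: "coeff p k = (if k \<le> N then fls_nth g (int (N - k)) else 0)" for k
  proof -
    have "coeff p k = (\<Sum>i\<le>N. if i = N - k \<and> k \<le> N then fls_nth g (int i) else 0)"
      unfolding p_def coeff_sum by (intro sum.cong) auto
    then show ?thesis by (cases "k \<le> N") simp_all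
  qed
  have "poly_at_z q = fls_X_inv ^ N"
    by (auto simp: fls_eq_iff poly_at_z_nth q_def)
  moreover have "poly_at_z p = g * fls_X_inv ^ N"
    unfolding fls_X_inv_power_times_conv_shift
  proof (rule fls_eqI)
    fix n
    show "fls_nth (poly_at_z p) n = fls_nth (fls_shift (int N) g) n"
      using assms[of "n + int N"] by (auto simp: poly_at_z_nth coeff_p of_nat_diff add.commute)
  qed
  ultimately have "g = poly_at_z p / poly_at_z q"
    using fls_X_inv_pow_nonzero[of N, where 'a = real]
    by (metis nonzero_mult_div_cancel_right)
  moreover have "degree p \<le> degree q"
    unfolding q_def by (subst degree_monom_eq) (auto simp: coeff_p intro!: degree_le)
  moreover have "q \<noteq> 0" by (simp add: q_def)
  moreover have "\<forall>x::complex. poly (map_poly of_real q) x = 0 \<longrightarrow> norm x < 1"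
    by (simp add: q_def map_poly_monom poly_monom)
  ultimately show ?thesis unfolding stable_rational_def by blast
qed

lemma stable_rational_0 [simp]: "stable_rational 0"
  by (rule stable_rational_fir[of 0]) simp

lemma RHinf_le_subset_RHinf: "G \<in> RHinf_le N \<Longrightarrow> G \<in> RHinf"
  by (auto simp: RHinf_def RHinf_le_iff intro!: stable_rational_fir[of N])

text \<open>\<open>imp\<close> records only nonnegative exponents; properness of stable responses
  settles the negative ones.\<close>

lemma RHinf_eqI:
  assumes "G \<in> RHinf" "H \<in> RHinf" "\<And>i. imp G i = imp H i"
  shows "G = H"
proof -
  have "fls_nth (G $ a $ b) n = fls_nth (H $ a $ b) n" for a b n
  proof (cases "n < 0")
    case True
    then show ?thesis using assms(1,2) by (simp add: RHinf_def stable_rational_proper)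
  next
    case False
    then show ?thesis using imp_nth[of G "nat n" a b] imp_nth[of H "nat n" a b] assms(3) by simp
  qed
  then show ?thesis by (simp add: vec_eq_iff fls_eq_iff)
qed


section \<open>The inner product on finite impulse responses\<close>

lemma trace_transpose_mult: "trace (transpose M ** N) = M \<bullet> N" for M N :: "real ^ 'k ^ 'm"
  unfolding trace_def transpose_def matrix_matrix_mult_def inner_vec_def
  by (simp add: sum.swap[where A = "UNIV :: 'k set"])

lemma h2_inner_eq: "h2_inner G H = (\<Sum>i. imp G i \<bullet> imp H i)"
  by (simp add: h2_inner_def trace_transpose_mult)

lemma h2_inner_commute: "h2_inner G H = h2_inner H G"
  by (simp add: h2_inner_eq inner_commute)

text \<open>One argument of finite order cuts the series to a finite sum while the other stays
  arbitrary; the linearity rules below inherit this asymmetry.\<close>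

lemma h2_inner_fir:
  assumes "H \<in> RHinf_le N"
  shows "h2_inner G H = (\<Sum>i\<le>N. imp G i \<bullet> imp H i)"
  unfolding h2_inner_eq using assms by (intro suminf_finite) (auto simp: imp_beyond)

lemma h2_inner_add_left:
  "H \<in> RHinf_le N \<Longrightarrow> h2_inner (G + G') H = h2_inner G H + h2_inner G' H"
  by (simp add: h2_inner_fir imp_add inner_add_left sum.distrib)

lemma h2_inner_diff_left:
  "H \<in> RHinf_le N \<Longrightarrow> h2_inner (G - G') H = h2_inner G H - h2_inner G' H"
  by (simp add: h2_inner_fir imp_diff inner_diff_left sum_subtractf)

lemma h2_inner_scale_left:
  "H \<in> RHinf_le N \<Longrightarrow> h2_inner (tf_scale c G) H = c * h2_inner G H"
  by (simp add: h2_inner_fir imp_scale sum_distrib_left)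

lemma h2_inner_add_right:
  "G \<in> RHinf_le N \<Longrightarrow> h2_inner G (H + H') = h2_inner G H + h2_inner G H'"
  by (metis h2_inner_add_left h2_inner_commute)

lemma h2_inner_diff_right:
  "G \<in> RHinf_le N \<Longrightarrow> h2_inner G (H - H') = h2_inner G H - h2_inner G H'"
  by (metis h2_inner_diff_left h2_inner_commute)

lemma h2_inner_scale_right:
  "G \<in> RHinf_le N \<Longrightarrow> h2_inner G (tf_scale c H) = c * h2_inner G H"
  by (metis h2_inner_scale_left h2_inner_commute)

lemma h2_inner_self_nonneg: "G \<in> RHinf_le N \<Longrightarrow> 0 \<le> h2_inner G G"
  by (simp add: h2_inner_fir sum_nonneg)

lemma h2_inner_self_eq_0: "G \<in> RHinf_le N \<Longrightarrow> h2_inner G G = 0 \<longleftrightarrow> G = 0"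
proof
  assume *: "G \<in> RHinf_le N" "h2_inner G G = 0"
  then have "\<forall>i\<in>{..N}. imp G i \<bullet> imp G i = 0"
    by (subst (asm) h2_inner_fir) (auto simp: sum_nonneg_eq_0_iff)
  then show "G = 0"
    using *(1) by (intro RHinf_le_eqI[of _ N]) auto
qed (simp add: h2_inner_fir[of 0 N])

lemma h2_norm_L2_set: "G \<in> RHinf_le N \<Longrightarrow> h2_norm G = L2_set (\<lambda>i. norm (imp G i)) {..N}"
  by (simp add: h2_norm_def h2_inner_fir L2_set_def dot_square_norm)

lemma h2_norm_nonneg: "G \<in> RHinf_le N \<Longrightarrow> 0 \<le> h2_norm G"
  by (simp add: h2_norm_def h2_inner_self_nonneg)

lemma h2_norm_square: "G \<in> RHinf_le N \<Longrightarrow> (h2_norm G)\<^sup>2 = h2_inner G G"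
  by (simp add: h2_norm_def h2_inner_self_nonneg)

lemma h2_norm_diff_square:
  assumes "G \<in> RHinf_le N" "H \<in> RHinf_le N"
  shows "(h2_norm (G - H))\<^sup>2 = h2_inner G G - 2 * h2_inner H G + h2_inner H H"
  using assms RHinf_le_diff[OF assms]
  by (simp add: h2_norm_square[of _ N] h2_inner_diff_left[of _ N] h2_inner_diff_right[of _ N]
      h2_inner_commute[of G H])

lemma h2_norm_eq_0: "G \<in> RHinf_le N \<Longrightarrow> h2_norm G = 0 \<longleftrightarrow> G = 0"
  by (simp add: h2_norm_def h2_inner_self_eq_0)

lemma h2_norm_triangle:
  assumes "G \<in> RHinf_le N" "H \<in> RHinf_le N"
  shows "h2_norm (G + H) \<le> h2_norm G + h2_norm H"
proof -
  have "L2_set (\<lambda>i. norm (imp (G + H) i)) {..N}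
      \<le> L2_set (\<lambda>i. norm (imp G i) + norm (imp H i)) {..N}"
    by (intro L2_set_mono) (auto simp: imp_add norm_triangle_ineq)
  then show ?thesis
    using L2_set_triangle_ineq[of "\<lambda>i. norm (imp G i)" "\<lambda>i. norm (imp H i)" "{..N}"] assms
    by (simp add: h2_norm_L2_set[of _ N] RHinf_le_add)
qed

lemma h2_norm_scale:
  assumes "G \<in> RHinf_le N"
  shows "h2_norm (tf_scale c G) = \<bar>c\<bar> * h2_norm G"
proof -
  have "h2_inner (tf_scale c G) (tf_scale c G) = c\<^sup>2 * h2_inner G G"
    using assms RHinf_le_scale[OF assms, of c]
    by (simp add: h2_inner_scale_left[of _ N] h2_inner_scale_right[of _ N] power2_eq_square)
  then show ?thesis
    by (simp add: h2_norm_def real_sqrt_mult)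
qed

lemma h2_Cauchy_Schwarz:
  assumes "G \<in> RHinf_le N" "H \<in> RHinf_le N"
  shows "h2_inner G H \<le> h2_norm G * h2_norm H"
proof -
  have "h2_inner G H \<le> (\<Sum>i\<le>N. \<bar>norm (imp G i)\<bar> * \<bar>norm (imp H i)\<bar>)"
    unfolding h2_inner_fir[OF assms(2)] by (intro sum_mono) (simp add: norm_cauchy_schwarz)
  also have "\<dots> \<le> h2_norm G * h2_norm H"
    unfolding h2_norm_L2_set[OF assms(1)] h2_norm_L2_set[OF assms(2)] by (rule L2_set_mult_ineq)
  finally show ?thesis .
qed

lemma norm_imp_le_h2_norm:
  assumes "G \<in> RHinf_le N" "i \<le> N"
  shows "norm (imp G i) \<le> h2_norm G"
  unfolding h2_norm_L2_set[OF assms(1)] using assms(2) by (intro member_le_L2_set) auto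


section \<open>Rows\<close>

text \<open>The coordinate projection onto the rows in \<open>P\<close>. Projections onto one
  actuator, onto the support of the desired controller and onto its complement all take this
  form.\<close>

definition keep_rows :: "'m set \<Rightarrow> ('m, 'k) tf \<Rightarrow> ('m::finite, 'k::finite) tf" where
  "keep_rows P G = (\<chi> a b. if a \<in> P then G $ a $ b else 0)"

lemma imp_keep_rows: "imp (keep_rows P G) i $ a = (if a \<in> P then imp G i $ a else 0)"
  by (simp add: vec_eq_iff imp_nth keep_rows_def)

lemma keep_rows_add: "keep_rows P (G + H) = keep_rows P G + keep_rows P H"
  by (simp add: vec_eq_iff keep_rows_def)

lemma keep_rows_diff: "keep_rows P (G - H) = keep_rows P G - keep_rows P H"
  by (simp add: vec_eq_iff keep_rows_def)

lemma keep_rows_scale: "keep_rows P (tf_scale c G) = tf_scale c (keep_rows P G)"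
  by (simp add: vec_eq_iff keep_rows_def tf_scale_nth)

lemma keep_rows_keep_rows: "keep_rows P (keep_rows Q G) = keep_rows (P \<inter> Q) G"
  by (simp add: vec_eq_iff keep_rows_def)

lemma keep_rows_0 [simp]: "keep_rows P 0 = 0"
  by (simp add: vec_eq_iff keep_rows_def)

lemma keep_rows_empty [simp]: "keep_rows {} G = 0"
  by (simp add: vec_eq_iff keep_rows_def)

lemma keep_rows_compl: "keep_rows P G + keep_rows (- P) G = G"
  by (simp add: vec_eq_iff keep_rows_def)

lemma keep_rows_eq_self_iff: "keep_rows P G = G \<longleftrightarrow> (\<forall>a. a \<notin> P \<longrightarrow> row a G = 0)"
  by (auto simp: vec_eq_iff keep_rows_def row_def)

lemma RHinf_le_keep_rows [intro]: "G \<in> RHinf_le N \<Longrightarrow> keep_rows P G \<in> RHinf_le N"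
  by (auto simp: RHinf_le_iff keep_rows_def)

lemma RHinf_keep_rows: "G \<in> RHinf \<Longrightarrow> keep_rows P G \<in> RHinf"
  by (auto simp: RHinf_def keep_rows_def)

lemma RHinf_monotf: "monotf k M \<in> RHinf"
  by (rule RHinf_le_subset_RHinf[OF RHinf_le_monotf])

lemma trunc_keep_rows: "trunc N (keep_rows P G) = keep_rows P (trunc N G)"
  by (auto intro!: RHinf_le_eqI[of _ N] simp: imp_trunc imp_keep_rows vec_eq_iff[of "imp _ _"])

lemma h2_norm_keep_rows_le:
  assumes "G \<in> RHinf_le N"
  shows "h2_norm (keep_rows P G) \<le> h2_norm G"
proof -
  have "norm (imp (keep_rows P G) k) \<le> norm (imp G k)" for k
    unfolding norm_vec_def[of "imp _ _"] by (intro L2_set_mono) (auto simp: imp_keep_rows)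
  then show ?thesis
    unfolding h2_norm_L2_set[OF assms] h2_norm_L2_set[OF RHinf_le_keep_rows[OF assms]]
    by (intro L2_set_mono) auto
qed

text \<open>Common form of the row-restricted optimization domain and of the domains of the
  restricted adjoints.\<close>

definition fir_rows :: "nat \<Rightarrow> 'a set \<Rightarrow> ('a::finite, 's::finite) tf set" where
  "fir_rows v P = {G \<in> RHinf_le v. keep_rows P G = G}"

lemma inner_imp_keep_rows:
  "imp G i \<bullet> imp (keep_rows P H) i = (\<Sum>a\<in>P. imp G i $ a \<bullet> imp H i $ a)"
proof -
  have "imp G i \<bullet> imp (keep_rows P H) i = (\<Sum>a\<in>UNIV. if a \<in> P then imp G i $ a \<bullet> imp H i $ a else 0)"
    unfolding inner_vec_def[of "imp G i"] by (intro sum.cong) (auto simp: imp_keep_rows)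
  then show ?thesis by (simp add: sum.If_cases)
qed

text \<open>Row projections are self-adjoint already coefficient by coefficient, for arbitrary
  arguments.\<close>

lemma h2_inner_keep_rows_swap: "h2_inner (keep_rows P G) H = h2_inner G (keep_rows P H)"
proof -
  have "imp (keep_rows P G) i \<bullet> imp H i = imp G i \<bullet> imp (keep_rows P H) i" for i
    using inner_imp_keep_rows[of G i P H] inner_imp_keep_rows[of H i P G]
    by (simp add: inner_commute)
  then show ?thesis by (simp add: h2_inner_eq)
qed

lemma h2_inner_keep_rows_disjoint:
  assumes "keep_rows P G = G" "keep_rows Q H = H" "P \<inter> Q = {}"
  shows "h2_inner G H = 0"
proof -
  have "h2_inner G H = h2_inner G (keep_rows (P \<inter> Q) H)"
    by (metis assms(1,2) h2_inner_keep_rows_swap keep_rows_keep_rows)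
  then show ?thesis using assms(3) by (simp add: h2_inner_eq)
qed

lemma h2_inner_sum_rows:
  assumes "H \<in> RHinf_le N"
  shows "h2_inner G H = (\<Sum>a\<in>UNIV. h2_inner (keep_rows {a} G) (keep_rows {a} H))"
proof -
  have "h2_inner (keep_rows {a} G) (keep_rows {a} H) = (\<Sum>i\<le>N. imp G i $ a \<bullet> imp H i $ a)" for a
    using assms
    by (simp add: h2_inner_keep_rows_swap keep_rows_keep_rows h2_inner_fir[of _ N]
        RHinf_le_keep_rows inner_imp_keep_rows)
  moreover have "h2_inner G H = (\<Sum>i\<le>N. \<Sum>a\<in>UNIV. imp G i $ a \<bullet> imp H i $ a)"
    by (simp only: h2_inner_fir[OF assms] inner_vec_def[of "imp G _"])
  ultimately show ?thesis by (simp add: sum.swap[where A = "{..N}"])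
qed

lemma h2_inner_monotf_rows:
  "h2_inner G (keep_rows P (monotf k M)) = (\<Sum>a\<in>P. imp G k $ a \<bullet> M $ a)"
proof -
  have imp_monotf: "imp (monotf k M) i = (if i = k then M else 0)" for i
    by (auto simp: vec_eq_iff imp_nth monotf_nth)
  have "h2_inner G (keep_rows P (monotf k M))
      = (\<Sum>i\<le>k. \<Sum>a\<in>P. imp G i $ a \<bullet> imp (monotf k M) i $ a)"
    by (simp add: h2_inner_fir[of _ k] RHinf_le_keep_rows RHinf_le_monotf inner_imp_keep_rows)
  also have "\<dots> = (\<Sum>i\<le>k. if i = k then \<Sum>a\<in>P. imp G i $ a \<bullet> M $ a else 0)"
    by (intro sum.cong) (auto simp: imp_monotf)
  finally show ?thesis by simp
qed

text \<open>Testing against the monomial built from \<open>imp G k\<close> itself yields a sum of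
  squared row norms, all of which must vanish.\<close>

lemma imp_row_eq_0:
  assumes "\<And>k M. h2_inner G (keep_rows P (monotf k M)) = 0" "a \<in> P"
  shows "imp G k $ a = 0"
proof -
  have "(\<Sum>a\<in>P. imp G k $ a \<bullet> imp G k $ a) = 0"
    using assms(1)[of k "imp G k"] by (simp add: h2_inner_monotf_rows)
  then show ?thesis using assms(2) by (simp add: sum_nonneg_eq_0_iff)
qed


section \<open>Actuator norms\<close>

lemma act_space_eq:
  "(act_space i :: ('a::finite, 's::finite) tf set) = {G \<in> RHinf. keep_rows {i} G = G}"
proof (intro subset_antisym subsetI)
  fix G :: "('a, 's) tf" assume "G \<in> act_space i"
  then obtain V :: "(1, 's) tf" where V: "V \<in> RHinf" "G = columnvector (axis i 1) ** V"
    by (auto simp: act_space_def)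
  have "G $ a $ b = (if a = i then V $ 1 $ b else 0)" for a b
    by (simp add: V(2) matrix_matrix_mult_def columnvector_def axis_def UNIV_1)
  then show "G \<in> {G \<in> RHinf. keep_rows {i} G = G}"
    using V(1) by (auto simp: RHinf_def keep_rows_def vec_eq_iff)
next
  fix G :: "('a, 's) tf" assume G: "G \<in> {G \<in> RHinf. keep_rows {i} G = G}"
  define V :: "(1, 's) tf" where "V = (\<chi> a b. G $ i $ b)"
  have "G $ a $ b = (if a = i then G $ i $ b else 0)" for a b
  proof -
    have "keep_rows {i} G $ a $ b = G $ a $ b" using G by simp
    then show ?thesis by (auto simp: keep_rows_def)
  qed
  moreover have "(columnvector (axis i 1) ** V) $ a $ b = (if a = i then G $ i $ b else 0)" for a b
    by (simp add: V_def matrix_matrix_mult_def columnvector_def axis_def UNIV_1)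
  ultimately have "G = columnvector (axis i 1) ** V"
    unfolding vec_eq_iff by metis
  moreover have "V \<in> RHinf" using G by (auto simp: V_def RHinf_def)
  ultimately show "G \<in> act_space i" by (auto simp: act_space_def)
qed

text \<open>Existence: what is removed lies on the other rows and is therefore orthogonal.
  Uniqueness: the monomials on row i belong to the space and determine every coefficient of that
  row.\<close>

lemma h2_proj_act_space:
  assumes "G \<in> RHinf"
  shows "h2_proj (act_space i) G = keep_rows {i} G"
  unfolding h2_proj_def
proof (rule the_equality)
  have "keep_rows (- {i}) (G - keep_rows {i} G) = G - keep_rows {i} G"
    by (simp add: vec_eq_iff keep_rows_def)
  then have "h2_inner (G - keep_rows {i} G) H = 0" if "H \<in> act_space i" for H
    using that by (intro h2_inner_keep_rows_disjoint[of "- {i}" _ "{i}"]) (auto simp: act_space_eq)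
  then show "keep_rows {i} G \<in> act_space i \<and> (\<forall>H\<in>act_space i. h2_inner (G - keep_rows {i} G) H = 0)"
    using assms by (auto simp: act_space_eq RHinf_keep_rows keep_rows_keep_rows)
next
  fix P assume P: "P \<in> act_space i \<and> (\<forall>H\<in>act_space i. h2_inner (G - P) H = 0)"
  have "keep_rows {i} (monotf k M) \<in> act_space i" for k M
    by (simp add: act_space_eq RHinf_monotf RHinf_keep_rows keep_rows_keep_rows)
  then have 0: "imp (G - P) k $ i = 0" for k
    using P by (intro imp_row_eq_0[of _ "{i}"]) auto
  have "P \<in> RHinf" "keep_rows {i} P = P" using P by (auto simp: act_space_eq)
  have "keep_rows {i} P = keep_rows {i} G"
    using 0 \<open>P \<in> RHinf\<close> assms
    by (intro RHinf_eqI) (auto simp: RHinf_keep_rows vec_eq_iff[of "imp _ _"] imp_keep_rows imp_diff)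
  then show "P = keep_rows {i} G" using \<open>keep_rows {i} P = P\<close> by simp
qed

lemma act_norm_eq:
  fixes G :: "('a::finite, 's::finite) tf"
  shows "act_norm G = (\<Sum>i\<in>UNIV. h2_norm (keep_rows {i} G))"
proof -
  have "(rowvector (axis i 1) ** G :: (1, 's) tf) $ a $ b = G $ i $ b" for i a b
    by (simp add: matrix_matrix_mult_def rowvector_def axis_def if_distrib[of "\<lambda>x. x * _"] cong: if_cong)
  then have "imp (rowvector (axis i 1) ** G :: (1, 's) tf) k $ a = imp G k $ i" for i k a
    by (simp add: vec_eq_iff imp_nth)
  then have "imp (rowvector (axis i 1) ** G :: (1, 's) tf) k \<bullet> imp (rowvector (axis i 1) ** G :: (1, 's) tf) k
      = imp (keep_rows {i} G) k \<bullet> imp (keep_rows {i} G) k" for i k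
    by (simp add: inner_imp_keep_rows imp_keep_rows inner_vec_def[of "imp (rowvector _ ** _) _"] UNIV_1)
  then show ?thesis by (simp add: act_norm_def h2_norm_def h2_inner_eq)
qed

lemma act_dual_norm_eq:
  "G \<in> RHinf \<Longrightarrow> act_dual_norm G = Max (range (\<lambda>i. h2_norm (keep_rows {i} G)))"
  by (simp add: act_dual_norm_def M_act_def image_image h2_proj_act_space)

context
  fixes N :: nat
begin

lemma act_norm_triangle:
  "G \<in> RHinf_le N \<Longrightarrow> H \<in> RHinf_le N \<Longrightarrow> act_norm (G + H) \<le> act_norm G + act_norm H"
  unfolding act_norm_eq sum.distrib[symmetric] keep_rows_add
  by (intro sum_mono h2_norm_triangle[of _ N]) auto

lemma act_norm_scale: "G \<in> RHinf_le N \<Longrightarrow> act_norm (tf_scale c G) = \<bar>c\<bar> * act_norm G"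
  unfolding act_norm_eq sum_distrib_left keep_rows_scale
  by (intro sum.cong h2_norm_scale[of _ N]) auto

lemma act_norm_nonneg: "G \<in> RHinf_le N \<Longrightarrow> 0 \<le> act_norm G"
  unfolding act_norm_eq by (intro sum_nonneg h2_norm_nonneg[of _ N]) auto

text \<open>Each row falls into exactly one of the two parts. This decomposability is what charges
  the full penalty for entries outside \<open>P\<close>.\<close>

lemma act_norm_compl: "act_norm G = act_norm (keep_rows P G) + act_norm (keep_rows (- P) G)"
proof -
  have "h2_norm (keep_rows {i} G)
      = h2_norm (keep_rows {i} (keep_rows P G)) + h2_norm (keep_rows {i} (keep_rows (- P) G))" for i
  proof -
    have "h2_norm 0 = 0" using h2_norm_eq_0[of 0 N] by simp
    then show ?thesis by (cases "i \<in> P") (simp_all add: keep_rows_keep_rows)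
  qed
  then show ?thesis by (simp add: act_norm_eq sum.distrib)
qed

lemma h2_norm_row_le_act_dual_norm:
  "G \<in> RHinf_le N \<Longrightarrow> h2_norm (keep_rows {i} G) \<le> act_dual_norm G"
  by (simp add: act_dual_norm_eq RHinf_le_subset_RHinf)

lemma act_dual_norm_le:
  assumes "G \<in> RHinf_le N" "\<And>i. h2_norm (keep_rows {i} G) \<le> c"
  shows "act_dual_norm G \<le> c"
  using assms by (subst act_dual_norm_eq) (auto simp: RHinf_le_subset_RHinf)

lemma act_dual_norm_nonneg: "G \<in> RHinf_le N \<Longrightarrow> 0 \<le> act_dual_norm G"
  by (meson RHinf_le_keep_rows h2_norm_nonneg h2_norm_row_le_act_dual_norm order_trans)

lemma act_dual_norm_triangle:
  assumes "G \<in> RHinf_le N" "H \<in> RHinf_le N"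
  shows "act_dual_norm (G + H) \<le> act_dual_norm G + act_dual_norm H"
proof (rule act_dual_norm_le)
  show "h2_norm (keep_rows {i} (G + H)) \<le> act_dual_norm G + act_dual_norm H" for i
    unfolding keep_rows_add
    using h2_norm_triangle[of "keep_rows {i} G" N "keep_rows {i} H"] assms
      h2_norm_row_le_act_dual_norm[of G i] h2_norm_row_le_act_dual_norm[of H i]
    by fastforce
qed (use assms in auto)

lemma act_dual_norm_scale:
  assumes "G \<in> RHinf_le N"
  shows "act_dual_norm (tf_scale c G) = \<bar>c\<bar> * act_dual_norm G"
proof -
  have "h2_norm (keep_rows {i} (tf_scale c G)) = \<bar>c\<bar> * h2_norm (keep_rows {i} G)" for i
    unfolding keep_rows_scale using assms by (intro h2_norm_scale[of _ N]) auto
  then have "act_dual_norm (tf_scale c G) = Max ((*) \<bar>c\<bar> ` range (\<lambda>i. h2_norm (keep_rows {i} G)))"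
    using RHinf_le_subset_RHinf[OF RHinf_le_scale[OF assms, of c]]
    by (simp add: act_dual_norm_eq image_image)
  also have "\<dots> = \<bar>c\<bar> * Max (range (\<lambda>i. h2_norm (keep_rows {i} G)))"
    \<comment> \<open>Multiplication by a nonnegative number is monotone, so it commutes with the
      maximum.\<close>
    by (intro mono_Max_commute[symmetric]) (auto simp: mono_def mult_left_mono)
  finally show ?thesis using assms by (simp add: act_dual_norm_eq RHinf_le_subset_RHinf)
qed

lemma act_dual_norm_diff:
  assumes "G \<in> RHinf_le N" "H \<in> RHinf_le N"
  shows "act_dual_norm (G - H) \<le> act_dual_norm G + act_dual_norm H"
  using act_dual_norm_triangle[of G "tf_scale (- 1) H"] act_dual_norm_scale[of H "- 1"] assms
    RHinf_le_scale[OF assms(2), of "- 1"]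
  by (simp add: tf_scale_minus_one)

text \<open>The l2 norm of the vector of row norms is at most its l1 norm.\<close>

lemma h2_norm_le_act_norm:
  assumes "G \<in> RHinf_le N"
  shows "h2_norm G \<le> act_norm G"
proof -
  have "(h2_norm G)\<^sup>2 = (\<Sum>a\<in>UNIV. (h2_norm (keep_rows {a} G))\<^sup>2)"
    using assms h2_inner_sum_rows[OF assms, of G]
    by (simp add: h2_norm_square[of _ N] RHinf_le_keep_rows)
  then have "h2_norm G = L2_set (\<lambda>a. h2_norm (keep_rows {a} G)) UNIV"
    unfolding L2_set_def using h2_norm_nonneg[OF assms] by (metis real_sqrt_unique)
  then show ?thesis
    using assms by (simp add: act_norm_eq L2_set_le_sum h2_norm_nonneg[of _ N] RHinf_le_keep_rows)
qed

lemma act_dual_norm_eq_0: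
  assumes "G \<in> RHinf_le N"
  shows "act_dual_norm G = 0 \<longleftrightarrow> G = 0"
proof
  assume "act_dual_norm G = 0"
  then have "h2_norm (keep_rows {i} G) = 0" for i
    using h2_norm_row_le_act_dual_norm[OF assms, of i] h2_norm_nonneg[of "keep_rows {i} G" N] assms
    by (metis RHinf_le_keep_rows order_antisym)
  then have "h2_norm G = 0"
    using h2_norm_le_act_norm[OF assms] h2_norm_nonneg[OF assms] by (simp add: act_norm_eq)
  then show "G = 0" using assms by (simp add: h2_norm_eq_0)
next
  assume "G = 0"
  then show "act_dual_norm G = 0" using act_dual_norm_scale[OF assms, of 0] by simp
qed

text \<open>Hoelder inequality for the dual pair: Cauchy-Schwarz row by row, then each row norm of G
  is replaced by the maximum. As H lives on \<open>P\<close>, only those rows of G count.\<close>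

lemma h2_inner_le_act_norm:
  assumes "G \<in> RHinf_le N" "H \<in> RHinf_le N" "keep_rows P H = H"
  shows "h2_inner G H \<le> act_dual_norm (keep_rows P G) * act_norm H"
proof -
  have "h2_inner G H = h2_inner (keep_rows P G) H"
    using assms(3) by (metis h2_inner_keep_rows_swap)
  also have "\<dots> = (\<Sum>a\<in>UNIV. h2_inner (keep_rows {a} (keep_rows P G)) (keep_rows {a} H))"
    by (rule h2_inner_sum_rows[OF assms(2)])
  also have "\<dots> \<le> (\<Sum>a\<in>UNIV. act_dual_norm (keep_rows P G) * h2_norm (keep_rows {a} H))"
  proof (rule sum_mono)
    fix a
    have "h2_inner (keep_rows {a} (keep_rows P G)) (keep_rows {a} H)
        \<le> h2_norm (keep_rows {a} (keep_rows P G)) * h2_norm (keep_rows {a} H)"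
      using assms by (intro h2_Cauchy_Schwarz[of _ N]) auto
    also have "\<dots> \<le> act_dual_norm (keep_rows P G) * h2_norm (keep_rows {a} H)"
      using assms
      by (intro mult_right_mono h2_norm_row_le_act_dual_norm h2_norm_nonneg[of _ N]) auto
    finally show "h2_inner (keep_rows {a} (keep_rows P G)) (keep_rows {a} H)
        \<le> act_dual_norm (keep_rows P G) * h2_norm (keep_rows {a} H)" .
  qed
  finally show ?thesis by (simp add: act_norm_eq sum_distrib_left)
qed

end

lemma act_norm_single_row:
  fixes G :: "('a::finite, 's::finite) tf"
  assumes "keep_rows {i} G = G"
  shows "act_norm G = h2_norm G"
proof -
  have "h2_norm (0 :: ('a, 's) tf) = 0" using h2_norm_eq_0[of 0 0] by simp
  then have "h2_norm (keep_rows {j} G) = (if j = i then h2_norm G else 0)" for j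
    using keep_rows_keep_rows[of "{j}" "{i}" G] assms by auto
  then show ?thesis by (simp add: act_norm_eq)
qed


section \<open>Active and inactive subspaces as row restrictions\<close>

lemma RHinf_le_Int_A_star: "RHinf_le v \<inter> A_star Us = fir_rows v (row_support Us)"
  by (auto simp: fir_rows_def A_star_def row_support_def keep_rows_eq_self_iff RHinf_le_subset_RHinf)

text \<open>Orthogonality is tested on monomials with rows in the support; conversely, responses on
  disjoint row sets are orthogonal.\<close>

lemma RHinf_le_Int_h2_orth_A_star:
  "RHinf_le v \<inter> h2_orth (A_star Us) = fir_rows v (- row_support Us)"
proof -
  have A: "A_star Us = {G \<in> RHinf. keep_rows (row_support Us) G = G}"
    by (auto simp: A_star_def row_support_def keep_rows_eq_self_iff)
  have "G \<in> h2_orth (A_star Us) \<longleftrightarrow> keep_rows (- row_support Us) G = G"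
    if G: "G \<in> RHinf_le v" for G
  proof
    assume "G \<in> h2_orth (A_star Us)"
    moreover have "keep_rows (row_support Us) (monotf k M) \<in> A_star Us" for k M
      by (simp add: A RHinf_monotf RHinf_keep_rows keep_rows_keep_rows)
    ultimately have "imp G k $ a = 0" if "a \<in> row_support Us" for a k
      using that by (intro imp_row_eq_0[of _ "row_support Us"]) (auto simp: h2_orth_def)
    then show "keep_rows (- row_support Us) G = G"
      using G by (intro RHinf_le_eqI[of _ v]) (auto simp: vec_eq_iff[of "imp _ _"] imp_keep_rows)
  next
    assume "keep_rows (- row_support Us) G = G"
    then show "G \<in> h2_orth (A_star Us)"
      using G by (auto simp: h2_orth_def A RHinf_le_subset_RHinf
          intro!: h2_inner_keep_rows_disjoint[of "- row_support Us" _ "row_support Us"])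
  qed
  then show ?thesis by (auto simp: fir_rows_def)
qed


section \<open>Linear maps on finite impulse responses\<close>

text \<open>Linearity is asked only for order at most \<open>v\<close>, so that the map U to
  \<open>adj (T U)\<close> is again an instance, \<open>adj\<close> being meaningful only on finite
  responses.\<close>

locale tf_linear =
  fixes T :: "('a::finite, 's::finite) tf \<Rightarrow> ('p::finite, 'r::finite) tf"
    and v t :: nat
  assumes add: "\<And>U V. U \<in> RHinf_le v \<Longrightarrow> V \<in> RHinf_le v \<Longrightarrow> T (U + V) = T U + T V"
    and scale: "\<And>U c. U \<in> RHinf_le v \<Longrightarrow> T (tf_scale c U) = tf_scale c (T U)"
    and mem: "\<And>U. U \<in> RHinf_le v \<Longrightarrow> T U \<in> RHinf_le t"
begin

lemma zero: "T 0 = 0"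
  using add[of 0 0] by simp

lemma diff: "U \<in> RHinf_le v \<Longrightarrow> V \<in> RHinf_le v \<Longrightarrow> T (U - V) = T U - T V"
  using add[of U "tf_scale (- 1) V"] scale[of V "- 1"] RHinf_le_scale[of V v "- 1"]
  by (simp add: tf_scale_minus_one)

lemma map_sum:
  "finite I \<Longrightarrow> (\<And>i. i \<in> I \<Longrightarrow> f i \<in> RHinf_le v) \<Longrightarrow> T (sum f I) = (\<Sum>i\<in>I. T (f i))"
proof (induction rule: finite_induct)
  case (insert i I)
  then show ?case using add[of "f i" "sum f I"] by (simp add: RHinf_le_sum)
qed (simp add: zero)

lemma map_fir: "T (fir v g) = (\<Sum>i\<le>v. T (monotf i (g i)))"
  unfolding fir_eq_sum_monotf
  by (rule map_sum) (auto intro: RHinf_le_monotf_le)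

lemma imp_map_fir: "imp (T (fir v g)) k = (\<Sum>i\<le>v. imp (T (monotf i (g i))) k)"
proof -
  have "imp (sum f I) k = (\<Sum>i\<in>I. imp (f i) k)" for f :: "nat \<Rightarrow> ('p, 'r) tf" and I
    by (induction I rule: infinite_finite_induct) (auto simp: imp_add)
  then show ?thesis by (simp add: map_fir)
qed

lemma linear_imp_map_monotf: "i \<le> v \<Longrightarrow> linear (\<lambda>M. imp (T (monotf i M)) k)"
  by (intro linearI)
    (simp_all add: RHinf_le_monotf_le monotf_add monotf_scale add scale imp_add imp_scale)

text \<open>The norm depends on finitely many coordinates of g, each through a linear map between
  Euclidean spaces, hence continuously for the product topology.\<close>

lemma continuous_h2_norm:
  assumes "y \<in> RHinf_le t"
  shows "continuous_on UNIV (\<lambda>g. h2_norm (y - T (fir v g)))"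
proof -
  have "continuous_on UNIV (\<lambda>g. imp (T (monotf i (g i))) k)" if "i \<le> v" for i k
  proof (rule continuous_on_compose2[of UNIV "\<lambda>M. imp (T (monotf i M)) k" UNIV "\<lambda>g. g i"])
    show "continuous_on UNIV (\<lambda>M. imp (T (monotf i M)) k)"
      using linear_imp_map_monotf[OF that] by (simp add: linear_continuous_on linear_conv_bounded_linear)
  qed (auto intro: continuous_on_product_coordinates)
  then have "continuous_on UNIV
      (\<lambda>g. sqrt (\<Sum>k\<le>t. (norm (imp y k - (\<Sum>i\<le>v. imp (T (monotf i (g i))) k)))\<^sup>2))"
    by (intro continuous_intros) auto
  moreover have "h2_norm (y - T (fir v g))
      = sqrt (\<Sum>k\<le>t. (norm (imp y k - (\<Sum>i\<le>v. imp (T (monotf i (g i))) k)))\<^sup>2)" for g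
    using assms
    by (subst h2_norm_L2_set[of _ t]) (auto simp: mem L2_set_def imp_diff imp_map_fir)
  ultimately show ?thesis by simp
qed

lemma ex_adjoint:
  assumes "G \<in> RHinf_le t"
  shows "\<exists>U\<in>RHinf_le v. \<forall>H\<in>RHinf_le v. h2_inner (T H) G = h2_inner H U"
proof -
  define \<phi> where "\<phi> i M = h2_inner (T (monotf i M)) G" for i M
  \<comment> \<open>Riesz vector of the functional \<open>\<phi> i\<close>: its adjoint maps the
    reals back to matrices, and the image of 1 represents it.\<close>
  define w where "w i = adjoint (\<phi> i) 1" for i
  have \<phi>: "\<phi> i M = M \<bullet> w i" if "i \<le> v" for i M
  proof -
    have "linear (\<phi> i)"
      unfolding \<phi>_def using that assms
      by (intro linearI) (simp_all add: RHinf_le_monotf_le monotf_add monotf_scale add scale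
          h2_inner_add_left[OF assms] h2_inner_scale_left[OF assms])
    then show ?thesis unfolding w_def by (simp add: adjoint_works)
  qed
  have "h2_inner (T H) G = h2_inner H (fir v w)" if H: "H \<in> RHinf_le v" for H
  proof -
    have "h2_inner (\<Sum>i\<in>I. f i) G = (\<Sum>i\<in>I. h2_inner (f i) G)" if "finite I" for f and I :: "nat set"
      using that
      by (induction rule: finite_induct)
        (simp_all add: h2_inner_fir[OF assms] imp_add inner_add_left sum.distrib)
    then have "h2_inner (T (fir v (imp H))) G = (\<Sum>i\<le>v. \<phi> i (imp H i))"
      by (simp add: map_fir \<phi>_def)
    also have "\<dots> = h2_inner H (fir v w)"
      by (simp add: \<phi> h2_inner_fir[of _ v] imp_fir)
    finally show ?thesis using H by (simp add: fir_imp)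
  qed
  then show ?thesis by (intro bexI[of _ "fir v w"]) auto
qed

text \<open>The adjoint on the whole space of order at most \<open>v\<close>. The restricted
  adjoints are its row projections, so one linear map serves both gains. For G of order
  \<open>t\<close> the choice exists by \<open>ex_adjoint\<close> and is determined by
  \<open>adj_unique\<close>.\<close>

definition adj where
  "adj G = (SOME U. U \<in> RHinf_le v \<and> (\<forall>H\<in>RHinf_le v. h2_inner (T H) G = h2_inner H U))"

lemma
  assumes "G \<in> RHinf_le t"
  shows adj_mem: "adj G \<in> RHinf_le v"
    and adj_works: "\<And>H. H \<in> RHinf_le v \<Longrightarrow> h2_inner (T H) G = h2_inner H (adj G)"
proof -
  have "adj G \<in> RHinf_le v \<and> (\<forall>H\<in>RHinf_le v. h2_inner (T H) G = h2_inner H (adj G))"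
    unfolding adj_def by (rule someI_ex) (use ex_adjoint[OF assms] in \<open>unfold Bex_def\<close>)
  then show "adj G \<in> RHinf_le v"
    and "\<And>H. H \<in> RHinf_le v \<Longrightarrow> h2_inner (T H) G = h2_inner H (adj G)" by auto
qed

text \<open>Row projection is self-adjoint and fixes the domain, so the restricted adjoint is the
  projected full one.\<close>

lemma h2_adjoint_on_fir_rows:
  assumes "G \<in> RHinf_le t"
  shows "h2_adjoint_on (fir_rows v P) T G = keep_rows P (adj G)"
  unfolding h2_adjoint_on_def
proof (rule the_equality)
  let ?W = "keep_rows P (adj G)"
  have "h2_inner (T H) G = h2_inner H ?W" if "H \<in> fir_rows v P" for H
    using that adj_works[OF assms, of H]
    by (auto simp: fir_rows_def h2_inner_keep_rows_swap[symmetric])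
  then show W: "?W \<in> fir_rows v P \<and> (\<forall>H\<in>fir_rows v P. h2_inner (T H) G = h2_inner H ?W)"
    using adj_mem[OF assms] by (auto simp: fir_rows_def keep_rows_keep_rows)
  fix U assume U: "U \<in> fir_rows v P \<and> (\<forall>H\<in>fir_rows v P. h2_inner (T H) G = h2_inner H U)"
  \<comment> \<open>The difference of two candidates belongs to the domain, so it may be tested
    against itself.\<close>
  have D: "U - ?W \<in> fir_rows v P"
    using U W by (auto simp: fir_rows_def keep_rows_diff)
  then have "h2_inner (U - ?W) U = h2_inner (U - ?W) ?W"
    using U W by metis
  then have "h2_inner (U - ?W) (U - ?W) = 0"
    using D by (subst h2_inner_diff_right[of _ v]) (auto simp: fir_rows_def)
  then have "U - ?W = 0"
    using D by (subst (asm) h2_inner_self_eq_0[of _ v]) (auto simp: fir_rows_def)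
  then show "U = ?W" by simp
qed

lemma adj_unique:
  assumes "G \<in> RHinf_le t" "U \<in> RHinf_le v"
    and "\<And>H. H \<in> RHinf_le v \<Longrightarrow> h2_inner (T H) G = h2_inner H U"
  shows "adj G = U"
proof -
  have D: "adj G - U \<in> RHinf_le v"
    using assms(2) adj_mem[OF assms(1)] by auto
  have "h2_inner (adj G - U) (adj G - U) = 0"
    using adj_works[OF assms(1) D] assms(3)[OF D] D by (subst h2_inner_diff_right[of _ v]) auto
  then have "adj G - U = 0"
    using D by (subst (asm) h2_inner_self_eq_0[of _ v]) auto
  then show ?thesis by simp
qed

lemma adj_add:
  assumes "G \<in> RHinf_le t" "G' \<in> RHinf_le t"
  shows "adj (G + G') = adj G + adj G'"
proof (rule adj_unique)
  fix H :: "('a, 's) tf" assume "H \<in> RHinf_le v"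
  then show "h2_inner (T H) (G + G') = h2_inner H (adj G + adj G')"
    using assms
    by (simp add: h2_inner_add_right[of _ t] h2_inner_add_right[of _ v] mem adj_works)
qed (use assms adj_mem in auto)

lemma adj_scale:
  assumes "G \<in> RHinf_le t"
  shows "adj (tf_scale c G) = tf_scale c (adj G)"
proof (rule adj_unique)
  fix H :: "('a, 's) tf" assume "H \<in> RHinf_le v"
  then show "h2_inner (T H) (tf_scale c G) = h2_inner H (tf_scale c (adj G))"
    using assms
    by (simp add: h2_inner_scale_right[of _ t] h2_inner_scale_right[of _ v] mem adj_works)
qed (use assms adj_mem in auto)

lemma tf_linear_adj_map: "tf_linear (\<lambda>U. adj (T U)) v v"
  by unfold_locales (simp_all add: add scale mem adj_add adj_scale adj_mem)

end

section \<open>Continuity, compactness and existence of minimizers\<close>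

lemma continuous_h2_norm_keep_rows: "continuous_on UNIV (\<lambda>g. h2_norm (keep_rows P (fir v g)))"
proof -
  \<comment> \<open>\<open>continuous_h2_norm\<close> treats a difference y - T U; with y = 0 the
    factor -1 makes this difference the row projection itself.\<close>
  interpret tf_linear "\<lambda>U. tf_scale (- 1) (keep_rows P U)" v v
    by unfold_locales
      (auto simp: keep_rows_add keep_rows_scale tf_scale_scale tf_scale_add)
  show ?thesis using continuous_h2_norm[of 0] by (simp add: tf_scale_minus_one)
qed

lemma continuous_act_norm: "continuous_on UNIV (\<lambda>g. act_norm (fir v g))"
  unfolding act_norm_eq by (intro continuous_intros continuous_h2_norm_keep_rows)

text \<open>The dimension of the space of controllers depends on \<open>v\<close>, so it is not a Euclidean space
  type; compactness comes from the product topology on coefficient sequences instead.\<close>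

definition coeff_box :: "nat \<Rightarrow> real \<Rightarrow> (nat \<Rightarrow> real ^ 's ^ 'a) set" where
  "coeff_box v r = (\<Pi>\<^sub>E i\<in>UNIV. if i \<le> v then cball 0 r else {0})"

text \<open>Tychonoff: every factor is a closed ball or the single point 0.\<close>

lemma compact_coeff_box: "compact (coeff_box v r)"
proof -
  have "compactin (product_topology (\<lambda>_. euclidean) UNIV) (coeff_box v r)"
    unfolding coeff_box_def by (subst compactin_PiE) auto
  then show ?thesis by (simp add: euclidean_product_topology)
qed

lemma imp_in_coeff_box:
  assumes "U \<in> RHinf_le v" "\<And>i. i \<le> v \<Longrightarrow> norm (imp U i) \<le> r"
  shows "imp U \<in> coeff_box v r"
  using assms by (auto simp: coeff_box_def imp_beyond)

text \<open>Serves to bound the set whose supremum is \<open>beta_gain\<close>: the unit ball of the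
  dual norm sits in a compact coefficient box.\<close>

lemma (in tf_linear) bounded_h2_norm:
  "\<exists>C. \<forall>U\<in>RHinf_le v. act_dual_norm U \<le> 1 \<longrightarrow> h2_norm (T U) \<le> C"
proof -
  \<comment> \<open>In the dual unit ball each of the \<open>CARD('a)\<close> rows has norm at most
    1, so \<open>act_norm\<close>, and with it every coefficient, is at most this radius.\<close>
  let ?r = "real CARD('a)"
  have "tf_linear (\<lambda>U. tf_scale (- 1) (T U)) v t"
    by unfold_locales (auto simp: add scale mem tf_scale_scale tf_scale_add)
  then have "continuous_on UNIV (\<lambda>g. h2_norm (0 - tf_scale (- 1) (T (fir v g))))"
    by (rule tf_linear.continuous_h2_norm) simp
  then have "compact ((\<lambda>g. h2_norm (T (fir v g))) ` coeff_box v ?r)"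
    by (intro compact_continuous_image compact_coeff_box)
      (auto simp: tf_scale_minus_one intro: continuous_on_subset)
  then obtain C where "\<forall>x\<in>(\<lambda>g. h2_norm (T (fir v g))) ` coeff_box v ?r. norm x \<le> C"
    using compact_imp_bounded bounded_iff by metis
  then have C: "h2_norm (T (fir v g)) \<le> C" if "g \<in> coeff_box v ?r" for g
    using that by fastforce
  have "h2_norm (T U) \<le> C" if U: "U \<in> RHinf_le v" "act_dual_norm U \<le> 1" for U
  proof -
    have "h2_norm (keep_rows {i} U) \<le> 1" for i
      using h2_norm_row_le_act_dual_norm[OF U(1), of i] U(2) by simp
    then have "act_norm U \<le> ?r"
      unfolding act_norm_eq using sum_bounded_above[of UNIV "\<lambda>i. h2_norm (keep_rows {i} U)" 1] by simp
    then have "imp U \<in> coeff_box v ?r"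
      using norm_imp_le_h2_norm[OF U(1)] h2_norm_le_act_norm[OF U(1)] U(1)
      by (intro imp_in_coeff_box) (auto intro: order_trans)
    then show ?thesis using C[of "imp U"] U(1) by (simp add: fir_imp)
  qed
  then show ?thesis by blast
qed

text \<open>Coercivity confines the search to a compact set, on which the continuous F attains its
  minimum.\<close>

lemma ex_minimizer_fir_rows:
  fixes F :: "('a::finite, 's::finite) tf \<Rightarrow> real"
  assumes cont: "continuous_on UNIV (\<lambda>g. F (fir v g))"
    and "c > 0" and coercive: "\<And>U. U \<in> RHinf_le v \<Longrightarrow> c * act_norm U \<le> F U"
  shows "\<exists>V\<in>fir_rows v P. \<forall>U\<in>fir_rows v P. F V \<le> F U"
proof -
  \<comment> \<open>Radius from comparison with 0: a coefficient of norm above r forces F U \<ge> c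
    * act_norm U > F 0.\<close>
  define r where "r = F 0 / c"
  \<comment> \<open>The row constraint is the zero set of a continuous function, hence closed, so
    \<open>K\<close> stays compact.\<close>
  define K :: "(nat \<Rightarrow> real ^ 's ^ 'a) set" where "K = coeff_box v r \<inter> {g. h2_norm (keep_rows (- P) (fir v g)) = 0}"
  have K_rows: "fir v g \<in> fir_rows v P" if "g \<in> K" for g
  proof -
    have "keep_rows (- P) (fir v g) = 0"
      using that h2_norm_eq_0[OF RHinf_le_keep_rows[OF RHinf_le_fir], of "- P" v g]
      by (simp add: K_def)
    then show ?thesis
      using keep_rows_compl[of P "fir v g"] by (simp add: fir_rows_def)
  qed
  have in_K: "imp U \<in> K" if "U \<in> fir_rows v P" "\<And>i. i \<le> v \<Longrightarrow> norm (imp U i) \<le> r" for U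
  proof -
    have "keep_rows (- P) U = keep_rows (- P \<inter> P) U"
      using that(1) by (metis (mono_tags, lifting) fir_rows_def keep_rows_keep_rows mem_Collect_eq)
    then show ?thesis
      using that h2_norm_eq_0[of 0 v]
      by (auto simp: K_def fir_imp fir_rows_def intro!: imp_in_coeff_box)
  qed
  have "F 0 \<ge> 0" using coercive[of 0] act_norm_nonneg[of 0 v] \<open>c > 0\<close>
    by (metis RHinf_le_zero mult_nonneg_nonneg order.trans less_imp_le)
  then have "r \<ge> 0" using \<open>c > 0\<close> by (simp add: r_def)
  then have "imp 0 \<in> K" by (intro in_K) (auto simp: fir_rows_def)
  moreover have "compact K"
    unfolding K_def
    by (intro compact_Int_closed compact_coeff_box closed_Collect_eq continuous_h2_norm_keep_rows
        continuous_on_const)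
  ultimately obtain g where g: "g \<in> K" "\<And>h. h \<in> K \<Longrightarrow> F (fir v g) \<le> F (fir v h)"
    using continuous_attains_inf[of K "\<lambda>g. F (fir v g)"] continuous_on_subset[OF cont] by auto
  have "F (fir v g) \<le> F U" if U: "U \<in> fir_rows v P" for U
  proof (cases "\<forall>i\<le>v. norm (imp U i) \<le> r")
    case True
    then show ?thesis using g(2)[OF in_K[OF U]] U by (auto simp: fir_imp fir_rows_def)
  next
    case False
    then obtain i where i: "i \<le> v" "r < norm (imp U i)" by auto
    have U': "U \<in> RHinf_le v" using U by (simp add: fir_rows_def)
    have "F (fir v g) \<le> F 0"
      using g(2)[OF \<open>imp 0 \<in> K\<close>] fir_imp[of "0 :: ('a, 's) tf" v] by simp
    also have "F 0 = c * r" using \<open>c > 0\<close> by (simp add: r_def)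
    also have "\<dots> \<le> c * act_norm U"
      using i norm_imp_le_h2_norm[OF U' i(1)] h2_norm_le_act_norm[OF U'] \<open>c > 0\<close>
      by (intro mult_left_mono) auto
    finally show ?thesis using coercive[OF U'] by simp
  qed
  then show ?thesis using K_rows[OF g(1)] by blast
qed


section \<open>The group-regularized least squares problem\<close>

context tf_linear
begin

definition cost :: "('p, 'r) tf \<Rightarrow> real \<Rightarrow> real \<Rightarrow> ('a, 's) tf \<Rightarrow> real" where
  "cost y \<rho> lam U = (h2_norm (y - T U))\<^sup>2 + \<rho> * (h2_norm U)\<^sup>2 + 2 * lam * act_norm U"

text \<open>Half the negative gradient of the smooth part of the cost.\<close>

definition residual_grad :: "('p, 'r) tf \<Rightarrow> real \<Rightarrow> ('a, 's) tf \<Rightarrow> ('a, 's) tf" where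
  "residual_grad y \<rho> U = adj (y - T U) - tf_scale \<rho> U"

lemma residual_grad_mem:
  "y \<in> RHinf_le t \<Longrightarrow> U \<in> RHinf_le v \<Longrightarrow> residual_grad y \<rho> U \<in> RHinf_le v"
  unfolding residual_grad_def by (intro RHinf_le_diff adj_mem RHinf_le_scale mem)

text \<open>Exact expansion: the quadratic part splits into its value, a linear term through
  \<open>residual_grad\<close> and a second-order term, while the nonsmooth norm is kept as a
  difference.\<close>

lemma cost_add:
  assumes y: "y \<in> RHinf_le t" and U: "U \<in> RHinf_le v" and E: "E \<in> RHinf_le v"
  shows "cost y \<rho> lam (U + E) = cost y \<rho> lam U
      - 2 * h2_inner E (residual_grad y \<rho> U)
      + ((h2_norm (T E))\<^sup>2 + \<rho> * (h2_norm E)\<^sup>2)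
      + 2 * lam * (act_norm (U + E) - act_norm U)"
proof -
  let ?r = "y - T U"
  have r: "?r \<in> RHinf_le t" "T E \<in> RHinf_le t"
    using y U E by (auto intro: mem)
  have "(h2_norm (?r - T E))\<^sup>2 = h2_inner ?r ?r - 2 * h2_inner (T E) ?r + h2_inner (T E) (T E)"
    using r by (rule h2_norm_diff_square)
  moreover have "y - T (U + E) = ?r - T E" using U E by (simp add: add)
  moreover have "h2_inner (T E) ?r = h2_inner E (adj ?r)" using r(1) E by (rule adj_works)
  moreover have "(h2_norm (U + E))\<^sup>2 = (h2_norm U)\<^sup>2 + 2 * h2_inner E U + (h2_norm E)\<^sup>2"
    using U E RHinf_le_add[OF U E]
    by (simp add: h2_norm_square[of _ v] h2_inner_add_left[of _ v] h2_inner_add_right[of _ v]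
        h2_inner_commute[of U E])
  moreover have "h2_inner E (residual_grad y \<rho> U) = h2_inner E (adj ?r) - \<rho> * h2_inner E U"
    using E U
    by (simp add: residual_grad_def h2_inner_diff_right[of _ v] h2_inner_scale_right[of _ v])
  ultimately show ?thesis
    using r by (simp add: cost_def h2_norm_square[of _ t] algebra_simps)
qed

text \<open>For a step s E the linear term scales with s, convexity bounds the change of
  \<open>act_norm\<close> by s times the full change, and the quadratic term scales with s^2.
  Dividing by s leaves a remainder that vanishes for small s.\<close>

lemma subgradient_of_minimizer:
  assumes y: "y \<in> RHinf_le t" and "\<rho> \<ge> 0" "lam > 0"
    and V: "V \<in> fir_rows v P" and min: "\<And>U. U \<in> fir_rows v P \<Longrightarrow> cost y \<rho> lam V \<le> cost y \<rho> lam U"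
    and E: "E \<in> fir_rows v P"
  shows "h2_inner E (residual_grad y \<rho> V) \<le> lam * (act_norm (V + E) - act_norm V)"
proof -
  define x where "x = h2_inner E (residual_grad y \<rho> V) - lam * (act_norm (V + E) - act_norm V)"
  define q where "q = (h2_norm (T E))\<^sup>2 + \<rho> * (h2_norm E)\<^sup>2"
  have VE: "V \<in> RHinf_le v" "E \<in> RHinf_le v" using V E by (auto simp: fir_rows_def)
  have *: "2 * x \<le> s * q" if s: "0 < s" "s \<le> 1" for s
  proof -
    let ?sE = "tf_scale s E"
    have sE: "?sE \<in> RHinf_le v" using VE by auto
    have "tf_scale (1 - s) V + tf_scale s (V + E) = V + ?sE"
      by (simp add: vec_eq_iff tf_scale_nth fls_eq_iff algebra_simps)
    then have "act_norm (V + ?sE) \<le> (1 - s) * act_norm V + s * act_norm (V + E)"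
      using act_norm_triangle[of "tf_scale (1 - s) V" v "tf_scale s (V + E)"] VE s
        act_norm_scale[of V v "1 - s"] act_norm_scale[of "V + E" v s]
      by (metis RHinf_le_add RHinf_le_scale abs_of_nonneg diff_ge_0_iff_ge less_eq_real_def)
    then have "act_norm (V + ?sE) - act_norm V \<le> s * (act_norm (V + E) - act_norm V)"
      by (simp add: algebra_simps)
    then have "2 * lam * (act_norm (V + ?sE) - act_norm V)
        \<le> 2 * lam * (s * (act_norm (V + E) - act_norm V))"
      using \<open>lam > 0\<close> by (intro mult_left_mono) auto
    moreover have "V + ?sE \<in> fir_rows v P"
      using V E by (auto simp: fir_rows_def keep_rows_add keep_rows_scale)
    then have "cost y \<rho> lam V \<le> cost y \<rho> lam (V + ?sE)" by (rule min)
    moreover have "h2_norm (T ?sE) = s * h2_norm (T E)" "h2_norm ?sE = s * h2_norm E"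
      using s VE by (simp_all add: scale h2_norm_scale[OF mem] h2_norm_scale[of _ v])
    moreover have "h2_inner ?sE (residual_grad y \<rho> V) = s * h2_inner E (residual_grad y \<rho> V)"
      using residual_grad_mem[OF y VE(1)] by (rule h2_inner_scale_left)
    ultimately have "s * (2 * x) \<le> s * (s * q)"
      unfolding x_def q_def using cost_add[OF y VE(1) sE, of \<rho> lam]
      by (simp add: algebra_simps power2_eq_square)
    then show ?thesis using s by simp
  qed
  have "x \<le> 0"
  proof (rule ccontr)
    assume "\<not> x \<le> 0"
    then have x: "0 < x" by simp
    moreover have "2 * x \<le> q" using *[of 1] by simp
    \<comment> \<open>The value s = x / q is admissible because s = 1 already gave 2 x \<le> q; it
      yields 2 x \<le> x, against x > 0.\<close>
    ultimately show False using *[of "x / q"] by (simp add: field_simps)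
  qed
  then show ?thesis by (simp add: x_def)
qed

text \<open>The gains enter as inequalities for every D, which keeps \<open>Inf\<close> and
  \<open>Sup\<close> out of the argument. \<open>U0\<close> stands for the truncated desired
  controller; a and b collect the data terms on active and inactive rows.\<close>

theorem support_restricted_minimizer:
  assumes y: "y \<in> RHinf_le t" and "\<rho> \<ge> 0" and U0: "U0 \<in> fir_rows v P"
    and "\<alpha> > 0" "\<beta> \<ge> 0" "\<delta> = \<beta> / \<alpha>" "\<delta> < 1"
    and alpha: "\<And>D. D \<in> fir_rows v P \<Longrightarrow>
      \<alpha> * act_dual_norm D \<le> act_dual_norm (keep_rows P (adj (T D)) + tf_scale \<rho> D)"
    and beta: "\<And>D. D \<in> fir_rows v P \<Longrightarrow>
      act_dual_norm (keep_rows (- P) (adj (T D))) \<le> \<beta> * act_dual_norm D"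
    and a: "a = act_dual_norm (keep_rows P (adj (y - T U0))) + \<rho> * act_dual_norm U0"
    and b: "b = act_dual_norm (keep_rows (- P) (adj (y - T U0)))"
    and lam: "lam > \<delta> / (1 - \<delta>) * a + 1 / (1 - \<delta>) * b"
  obtains V where "V \<in> fir_rows v P"
    and "\<And>U. U \<in> RHinf_le v \<Longrightarrow> U \<noteq> V \<Longrightarrow> cost y \<rho> lam V < cost y \<rho> lam U"
    and "\<alpha> * act_dual_norm (U0 - V) \<le> lam + a"
proof -
  have U0v: "U0 \<in> RHinf_le v" and U0P: "keep_rows P U0 = U0"
    using U0 by (auto simp: fir_rows_def)
  define R where "R = y - T U0"
  have R: "R \<in> RHinf_le t" unfolding R_def using y U0v by (auto intro: mem)
  have "0 \<le> \<delta>" using assms by simp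
  have "0 \<le> a" "0 \<le> b"
    unfolding a b R_def[symmetric] using \<open>\<rho> \<ge> 0\<close> U0v adj_mem[OF R]
    by (auto intro!: add_nonneg_nonneg mult_nonneg_nonneg act_dual_norm_nonneg[of _ v])
  then have "0 \<le> \<delta> / (1 - \<delta>) * a + 1 / (1 - \<delta>) * b"
    using \<open>0 \<le> \<delta>\<close> \<open>\<delta> < 1\<close> by auto
  then have "lam > 0" using lam by simp
  have "(1 - \<delta>) * (\<delta> / (1 - \<delta>) * a + 1 / (1 - \<delta>) * b) < (1 - \<delta>) * lam"
    using lam \<open>\<delta> < 1\<close> by (intro mult_strict_left_mono) auto
  moreover have "(1 - \<delta>) * (\<delta> / (1 - \<delta>) * a + 1 / (1 - \<delta>) * b) = \<delta> * a + b"
    using \<open>\<delta> < 1\<close> by (simp add: distrib_left)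
  \<comment> \<open>Multiplied by 1 - \<delta>, the threshold on lam reads \<delta> a + b < (1 -
    \<delta>) lam; rearranged, it is what the dual estimate on the inactive rows requires.\<close>
  ultimately have lam': "\<delta> * (lam + a) + b < lam"
    by (simp add: algebra_simps)

  have "continuous_on UNIV (\<lambda>g. cost y \<rho> lam (fir v g))"
  proof -
    have "continuous_on UNIV (\<lambda>g. h2_norm (fir v g :: ('a, 's) tf))"
      using continuous_h2_norm_keep_rows[of UNIV v] by (simp add: keep_rows_def)
    then show ?thesis
      unfolding cost_def by (intro continuous_intros continuous_h2_norm continuous_act_norm y)
  qed
  moreover have "2 * lam * act_norm U \<le> cost y \<rho> lam U" for U
    using \<open>\<rho> \<ge> 0\<close> by (simp add: cost_def)
  ultimately obtain V where V: "V \<in> fir_rows v P"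
    and min: "\<And>U. U \<in> fir_rows v P \<Longrightarrow> cost y \<rho> lam V \<le> cost y \<rho> lam U"
    using ex_minimizer_fir_rows[of "cost y \<rho> lam" v "2 * lam" P] \<open>lam > 0\<close> by auto
  have Vv: "V \<in> RHinf_le v" and VP: "keep_rows P V = V" using V by (auto simp: fir_rows_def)
  define g where "g = residual_grad y \<rho> V"
  have g: "g \<in> RHinf_le v" unfolding g_def by (rule residual_grad_mem[OF y Vv])
  have subgrad: "h2_inner E g \<le> lam * (act_norm (V + E) - act_norm V)" if "E \<in> fir_rows v P" for E
    unfolding g_def using subgradient_of_minimizer[OF y \<open>\<rho> \<ge> 0\<close> \<open>lam > 0\<close> V min that] .

  have gP: "act_dual_norm (keep_rows P g) \<le> lam"
  proof (rule act_dual_norm_le)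
    fix i
    \<comment> \<open>Test direction: an active row of the gradient itself, which stays in the
      feasible subspace. The subgradient inequality then becomes |e|^2 \<le> lam |e|.\<close>
    define e where "e = keep_rows {i} (keep_rows P g)"
    have e: "e \<in> RHinf_le v" using g by (auto simp: e_def)
    have "keep_rows P e = e" by (simp add: e_def keep_rows_keep_rows Int_ac)
    have "h2_inner e g = (h2_norm e)\<^sup>2"
    proof -
      have "h2_inner e g = h2_inner (keep_rows ({i} \<inter> P) e) g"
        by (simp add: e_def keep_rows_keep_rows Int_ac)
      then show ?thesis
        using e by (simp add: h2_inner_keep_rows_swap h2_norm_square[of _ v] e_def keep_rows_keep_rows)
    qed
    moreover have "h2_inner e g \<le> lam * (act_norm (V + e) - act_norm V)"
      using e \<open>keep_rows P e = e\<close> by (intro subgrad) (simp add: fir_rows_def)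
    moreover have "act_norm (V + e) - act_norm V \<le> h2_norm e"
      using act_norm_triangle[OF Vv e] act_norm_single_row[of i e]
      by (simp add: e_def keep_rows_keep_rows)
    then have "lam * (act_norm (V + e) - act_norm V) \<le> lam * h2_norm e"
      using \<open>lam > 0\<close> by (intro mult_left_mono) auto
    ultimately have "h2_norm e * h2_norm e \<le> lam * h2_norm e"
      by (simp add: power2_eq_square)
    then show "h2_norm e \<le> lam"
      using h2_norm_nonneg[OF e] \<open>lam > 0\<close> by (cases "h2_norm e = 0") auto
  qed (use g in auto)

  define D where "D = U0 - V"
  have Dv: "D \<in> RHinf_le v" and D: "D \<in> fir_rows v P"
    using U0 V by (auto simp: D_def fir_rows_def keep_rows_diff)
  have TD: "T D \<in> RHinf_le t" by (rule mem[OF Dv])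
  have "y - T V = R + T D"
    using U0v Vv by (simp add: R_def D_def diff)
  then have g_eq: "g = adj R + adj (T D) - tf_scale \<rho> V"
    using R TD by (simp add: g_def residual_grad_def adj_add)
  note adjs = adj_mem[OF R] adj_mem[OF TD]

  have dist: "\<alpha> * act_dual_norm D \<le> lam + a"
  proof -
    \<comment> \<open>The \<rho> V in g and \<rho> D = \<rho> (U0 - V) combine to \<rho> U0, so V
      remains only inside g, whose active part is already bounded.\<close>
    have "keep_rows P (adj (T D)) + tf_scale \<rho> D
        = (keep_rows P g - keep_rows P (adj R)) + tf_scale \<rho> U0"
      unfolding g_eq D_def keep_rows_diff keep_rows_add keep_rows_scale VP
      by (simp add: vec_eq_iff tf_scale_nth algebra_simps)
    then have "\<alpha> * act_dual_norm D
        \<le> act_dual_norm ((keep_rows P g - keep_rows P (adj R)) + tf_scale \<rho> U0)"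
      using alpha[OF D] by simp
    also have "\<dots> \<le> act_dual_norm (keep_rows P g - keep_rows P (adj R)) + act_dual_norm (tf_scale \<rho> U0)"
      using g adjs U0v by (intro act_dual_norm_triangle[of _ v]) auto
    also have "\<dots> \<le> act_dual_norm (keep_rows P g) + act_dual_norm (keep_rows P (adj R))
        + \<rho> * act_dual_norm U0"
      using g adjs U0v act_dual_norm_diff[of "keep_rows P g" v "keep_rows P (adj R)"] \<open>\<rho> \<ge> 0\<close>
        act_dual_norm_scale[OF U0v, of \<rho>]
      by auto
    also have "\<dots> \<le> lam + a" using gP by (simp add: a R_def)
    finally show ?thesis .
  qed

  have gQ: "act_dual_norm (keep_rows (- P) g) < lam"
  proof -
    \<comment> \<open>V vanishes outside \<open>P\<close>, so the \<rho> term drops out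
      there.\<close>
    have "keep_rows (- P) V = keep_rows (- P \<inter> P) V" by (metis VP keep_rows_keep_rows)
    then have "keep_rows (- P) g = keep_rows (- P) (adj R) + keep_rows (- P) (adj (T D))"
      by (simp add: g_eq keep_rows_add keep_rows_diff keep_rows_scale)
    then have "act_dual_norm (keep_rows (- P) g)
        \<le> b + act_dual_norm (keep_rows (- P) (adj (T D)))"
      unfolding b R_def[symmetric] using adjs by (auto intro!: act_dual_norm_triangle[of _ v])
    \<comment> \<open>Here \<beta> = \<delta> \<alpha>, so that \<open>dist\<close> applies to the
      product of \<alpha> with the norm of D.\<close>
    also have "\<dots> \<le> b + \<delta> * (\<alpha> * act_dual_norm D)"
      using beta[OF D] assms(4,6) by simp
    also have "\<dots> \<le> b + \<delta> * (lam + a)"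
      using dist \<open>0 \<le> \<delta>\<close> by (intro add_left_mono mult_left_mono)
    finally show ?thesis using lam' by simp
  qed

  have "cost y \<rho> lam V < cost y \<rho> lam U" if U: "U \<in> RHinf_le v" "U \<noteq> V" for U
  proof -
    define E where "E = U - V"
    \<comment> \<open>On the rows in \<open>P\<close> the subgradient inequality controls the linear
      term; on the others Hoelder and the strict bound \<open>gQ\<close> do.\<close>
    define E1 where "E1 = keep_rows P E"
    define E2 where "E2 = keep_rows (- P) E"
    define q where "q = (h2_norm (T E))\<^sup>2 + \<rho> * (h2_norm E)\<^sup>2"
    have E: "E \<in> RHinf_le v" "E1 \<in> RHinf_le v" "E2 \<in> RHinf_le v" "E \<noteq> 0"
      using U Vv by (auto simp: E_def E1_def E2_def)
    have E12: "E1 + E2 = E" unfolding E1_def E2_def by (rule keep_rows_compl)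
    have "q \<ge> 0" using \<open>\<rho> \<ge> 0\<close> by (simp add: q_def)
    have UVE: "U = V + E" by (simp add: E_def)
    have cost_eq: "cost y \<rho> lam U = cost y \<rho> lam V - 2 * h2_inner E g + q
        + 2 * lam * (act_norm U - act_norm V)"
      unfolding UVE q_def g_def by (rule cost_add[OF y Vv E(1)])
    have "h2_inner E g = h2_inner E1 g + h2_inner E2 g"
      unfolding E12[symmetric] by (rule h2_inner_add_left[OF g])
    moreover have "h2_inner E1 g \<le> lam * (act_norm (V + E1) - act_norm V)"
      using E by (intro subgrad) (auto simp: fir_rows_def E1_def keep_rows_keep_rows)
    moreover have "h2_inner E2 g \<le> act_dual_norm (keep_rows (- P) g) * act_norm E2"
      using h2_inner_le_act_norm[OF g E(3), of "- P"]
      by (simp add: h2_inner_commute[of g] E2_def keep_rows_keep_rows)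
    moreover have "act_norm U = act_norm (V + E1) + act_norm E2"
    proof -
      have "keep_rows P U = V + E1" "keep_rows (- P) U = E2"
        using VP keep_rows_compl[of P V] by (simp_all add: UVE keep_rows_add E1_def E2_def)
      then show ?thesis using act_norm_compl[of U P] by simp
    qed
    \<comment> \<open>The cost gap is at least the curvature q plus twice the dual slack times
      \<open>act_norm E2\<close>. Both are nonnegative, and the cases below show that one is
      positive.\<close>
    ultimately have gap: "cost y \<rho> lam V + q
        + 2 * ((lam - act_dual_norm (keep_rows (- P) g)) * act_norm E2) \<le> cost y \<rho> lam U"
      unfolding cost_eq by (simp add: algebra_simps)
    show ?thesis
    proof (cases "E2 = 0")
      case False
      then have "0 < act_norm E2"
        using h2_norm_le_act_norm[OF E(3)] h2_norm_nonneg[OF E(3)] h2_norm_eq_0[OF E(3)] by linarith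
      then have "0 < (lam - act_dual_norm (keep_rows (- P) g)) * act_norm E2" using gQ by simp
      then show ?thesis using gap \<open>q \<ge> 0\<close> by simp
    next
      case True
      \<comment> \<open>With no part outside \<open>P\<close>, strictness must come from q. If q =
        0, then T E = 0 and, as E is nonzero, \<rho> = 0; the lower gain \<alpha> > 0 then forces E
        = 0.\<close>
      have "q \<noteq> 0"
      proof
        assume "q = 0"
        then have "(h2_norm (T E))\<^sup>2 = 0" "\<rho> * (h2_norm E)\<^sup>2 = 0"
          using \<open>\<rho> \<ge> 0\<close> zero_le_power2[of "h2_norm (T E)"] zero_le_power2[of "h2_norm E"]
          unfolding q_def by (smt (verit) mult_nonneg_nonneg)+
        then have "T E = 0" "\<rho> = 0"
          using E h2_norm_eq_0[OF mem[OF E(1)]] h2_norm_eq_0[OF E(1)] by auto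
        moreover have "adj 0 = 0" using adj_scale[of 0 0] by (intro adj_unique) (simp_all add: h2_inner_fir[of 0 0])
        moreover have "E \<in> fir_rows v P"
          using True E12 E(1) by (simp add: fir_rows_def E1_def)
        ultimately have "\<alpha> * act_dual_norm E \<le> act_dual_norm (0 + tf_scale 0 E :: ('a, 's) tf)"
          using alpha[of E] by simp
        also have "\<dots> = 0" using act_dual_norm_scale[OF E(1), of 0] by simp
        finally have "act_dual_norm E = 0"
          using \<open>\<alpha> > 0\<close> act_dual_norm_nonneg[OF E(1)] by (simp add: mult_le_0_iff)
        then show False using act_dual_norm_eq_0[OF E(1)] \<open>E \<noteq> 0\<close> by simp
      qed
      moreover have "0 \<le> (lam - act_dual_norm (keep_rows (- P) g)) * act_norm E2"
        using gQ act_norm_nonneg[OF E(3)] by simp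
      ultimately show ?thesis using gap \<open>q \<ge> 0\<close> by linarith
    qed
  qed
  then show ?thesis using that[OF V] dist by (simp add: D_def)
qed

end


section \<open>The Youla map and its restricted gains\<close>

lemma tf_linear_Lmap:
  "tf_linear (Lmap A B2 C1 t :: ('a::finite, 's::finite) tf \<Rightarrow> ('p::finite, 's) tf) v t"
proof
  fix U V :: "('a, 's) tf" and c
  show "Lmap A B2 C1 t (U + V) = Lmap A B2 C1 t U + Lmap A B2 C1 t V"
    by (simp add: Lmap_def youla_map_def matrix_add_ldistrib trunc_add)
  show "Lmap A B2 C1 t (tf_scale c U) = tf_scale c (Lmap A B2 C1 t U)"
    by (simp add: Lmap_def youla_map_def matrix_mult_tf_scale trunc_scale)
  show "Lmap A B2 C1 t U \<in> RHinf_le t" by (simp add: Lmap_def)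
qed

theorem theorem1:
  fixes A :: "real ^ 'n ^ 'n"
    and B1 :: "real ^ 's ^ 'n"
    and B2 :: "real ^ 'a ^ 'n"
    and C1 :: "real ^ 'n ^ 'p"
    and Us :: "('a, 's) tf"
    and \<rho> lam \<delta> :: real
    and t v :: nat
  assumes "invertible B1"
    and "Us \<in> RHinf" and "Us \<noteq> 0"
    and "\<rho> \<ge> 0"
    and "1 \<le> t" and "1 \<le> v" and "v \<le> t"
    and "alpha_gain A B2 C1 \<rho> Us t v > 0"
    and "\<delta> = beta_gain A B2 C1 Us t v / alpha_gain A B2 C1 \<rho> Us t v"
    and "0 \<le> \<delta>" and "\<delta> < 1"
    and "lam > \<delta> / (1 - \<delta>) *
               (act_dual_norm (Ladj A B2 C1 t v (A_star Us)
                  (W_res A B1 B2 C1 Us t + T_res A B2 C1 Us t v))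
                + \<rho> * act_dual_norm (trunc v Us))
             + 1 / (1 - \<delta>) *
               act_dual_norm (Ladj A B2 C1 t v (h2_orth (A_star Us))
                  (W_res A B1 B2 C1 Us t + T_res A B2 C1 Us t v))"
  shows "\<exists>Uhat. minimizers (objective A B1 B2 C1 \<rho> lam t) (RHinf_le v \<inter> A_star Us) = {Uhat}
           \<and> minimizers (objective A B1 B2 C1 \<rho> lam t) (RHinf_le v) = {Uhat}
           \<and> row_support Uhat \<subseteq> row_support Us
           \<and> (\<forall>S \<in> M_star Us.
                 h2_norm (h2_proj S (trunc v Us)) >
                   1 / alpha_gain A B2 C1 \<rho> Us t v *
                     (lam + act_dual_norm (Ladj A B2 C1 t v (A_star Us)
                            (W_res A B1 B2 C1 Us t + T_res A B2 C1 Us t v))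
                        + \<rho> * act_dual_norm (trunc v Us))
                 \<longrightarrow> h2_proj S Uhat \<noteq> 0)"
proof -
  interpret L: tf_linear "Lmap A B2 C1 t :: ('a, 's) tf \<Rightarrow> ('p, 's) tf" v t
    by (rule tf_linear_Lmap)
  define P where "P = row_support Us"
  define y :: "('p, 's) tf" where "y = trunc t (open_loop A B1 C1)"
  define \<alpha> where "\<alpha> = alpha_gain A B2 C1 \<rho> Us t v"
  define \<beta> where "\<beta> = beta_gain A B2 C1 Us t v"
  let ?L = "Lmap A B2 C1 t :: ('a, 's) tf \<Rightarrow> ('p, 's) tf"
  have y: "y \<in> RHinf_le t" by (simp add: y_def)
  have D_star: "RHinf_le v \<inter> A_star Us = fir_rows v P"
    unfolding P_def by (rule RHinf_le_Int_A_star)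
  have D_orth: "RHinf_le v \<inter> h2_orth (A_star Us) = fir_rows v (- P)"
    unfolding P_def by (rule RHinf_le_Int_h2_orth_A_star)
  have Ladj_star: "Ladj A B2 C1 t v (A_star Us) G = keep_rows P (L.adj G)"
    and Ladj_orth: "Ladj A B2 C1 t v (h2_orth (A_star Us)) G = keep_rows (- P) (L.adj G)"
    if "G \<in> RHinf_le t" for G :: "('p, 's) tf"
    using that by (simp_all add: Ladj_def D_star D_orth L.h2_adjoint_on_fir_rows)
  define U0 where "U0 = trunc v Us"
  have U0v: "U0 \<in> RHinf_le v" by (simp add: U0_def)
  have U0: "U0 \<in> fir_rows v P"
  proof -
    have "keep_rows P Us = Us" by (simp add: keep_rows_eq_self_iff P_def row_support_def)
    then have "keep_rows P U0 = U0"
      by (simp add: U0_def flip: trunc_keep_rows)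
    then show ?thesis by (simp add: fir_rows_def U0v)
  qed
  have R: "W_res A B1 B2 C1 Us t + T_res A B2 C1 Us t v = y - ?L U0"
  proof -
    \<comment> \<open>The outer instance works at order \<open>v\<close>, but
      \<open>trunc t Us\<close> has order \<open>t\<close>; linearity at order \<open>t\<close> lets
      W + T telescope.\<close>
    interpret Lt: tf_linear ?L t t by (rule tf_linear_Lmap)
    have "trunc v Us \<in> RHinf_le t" using RHinf_le_mono[OF RHinf_le_trunc \<open>v \<le> t\<close>] .
    then show ?thesis
      by (simp add: W_res_def T_res_def y_def U0_def Lt.diff)
  qed
  have Rt: "y - ?L U0 \<in> RHinf_le t" using y L.mem[OF U0v] by auto

  have "0 < \<alpha>" using assms by (simp add: \<alpha>_def)
  \<comment> \<open>The sign is read off \<delta> \<ge> 0 and \<alpha> > 0 rather than from the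
    supremum.\<close>
  have "0 \<le> \<beta>"
    using assms by (simp add: \<alpha>_def \<beta>_def zero_le_divide_iff)
  \<comment> \<open>The gains are defined on the unit sphere or ball; rescaling extends their bounds
    to every nonzero D.\<close>
  have normalize: "act_dual_norm (tf_scale (1 / act_dual_norm D) D) = 1"
      "tf_scale (1 / act_dual_norm D) D \<in> fir_rows v P" "0 < act_dual_norm D"
    if "D \<in> fir_rows v P" "D \<noteq> 0" for D :: "('a, 's) tf"
  proof -
    have D: "D \<in> RHinf_le v" using that by (simp add: fir_rows_def)
    show "0 < act_dual_norm D"
      using act_dual_norm_nonneg[OF D] act_dual_norm_eq_0[OF D] that by linarith
    then show "act_dual_norm (tf_scale (1 / act_dual_norm D) D) = 1"
      by (simp add: act_dual_norm_scale[OF D])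
    show "tf_scale (1 / act_dual_norm D) D \<in> fir_rows v P"
      using that by (auto simp: fir_rows_def keep_rows_scale)
  qed
  interpret M: tf_linear "\<lambda>U. L.adj (?L U)" v v by (rule L.tf_linear_adj_map)

  have alpha: "\<alpha> * act_dual_norm D \<le> act_dual_norm (keep_rows P (L.adj (?L D)) + tf_scale \<rho> D)"
    if D: "D \<in> fir_rows v P" for D
  proof (cases "D = 0")
    case True
    then show ?thesis
      using act_dual_norm_eq_0[of "0 :: ('a, 's) tf" v] by (simp add: M.zero)
  next
    case False
    let ?c = "1 / act_dual_norm D"
    let ?h = "\<lambda>D. keep_rows P (L.adj (?L D)) + tf_scale \<rho> D"
    have Dv: "D \<in> RHinf_le v" using D by (simp add: fir_rows_def)
    have h: "?h D \<in> RHinf_le v" if "D \<in> RHinf_le v" for D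
      using that M.mem by auto
    have "\<alpha> \<le> act_dual_norm (?h (tf_scale ?c D))"
      unfolding \<alpha>_def alpha_gain_def
    proof (rule cInf_lower)
      show "act_dual_norm (?h (tf_scale ?c D))
          \<in> {act_dual_norm (Ladj A B2 C1 t v (A_star Us) (?L \<Delta>) + tf_scale \<rho> \<Delta>) |\<Delta>.
              act_dual_norm \<Delta> = 1 \<and> \<Delta> \<in> A_star Us \<inter> RHinf_le v}"
        using normalize[OF D False] D_star L.mem[OF RHinf_le_scale[OF Dv, of ?c]]
        by (intro CollectI exI[of _ "tf_scale ?c D"]) (auto simp: Ladj_star)
      show "bdd_below {act_dual_norm (Ladj A B2 C1 t v (A_star Us) (?L \<Delta>) + tf_scale \<rho> \<Delta>) |\<Delta>.
              act_dual_norm \<Delta> = 1 \<and> \<Delta> \<in> A_star Us \<inter> RHinf_le v}"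
        using h by (auto simp: Ladj_star L.mem intro!: bdd_belowI[of _ 0] act_dual_norm_nonneg[of _ v])
    qed
    also have "?h (tf_scale ?c D) = tf_scale ?c (?h D)"
      by (simp add: M.scale[OF Dv] keep_rows_scale tf_scale_add tf_scale_scale mult.commute)
    also have "act_dual_norm (tf_scale ?c (?h D)) = ?c * act_dual_norm (?h D)"
      using normalize(3)[OF D False] by (simp add: act_dual_norm_scale[OF h[OF Dv]])
    finally show ?thesis using normalize(3)[OF D False] by (simp add: field_simps)
  qed

  have beta: "act_dual_norm (keep_rows (- P) (L.adj (?L D))) \<le> \<beta> * act_dual_norm D"
    if D: "D \<in> fir_rows v P" for D
  proof (cases "D = 0")
    case True
    then show ?thesis
      using act_dual_norm_eq_0[of "0 :: ('a, 's) tf" v] by (simp add: M.zero)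
  next
    case False
    let ?c = "1 / act_dual_norm D"
    let ?h = "\<lambda>D. keep_rows (- P) (L.adj (?L D))"
    have Dv: "D \<in> RHinf_le v" using D by (simp add: fir_rows_def)
    have h: "?h D \<in> RHinf_le v" if "D \<in> RHinf_le v" for D
      using that M.mem by auto
    \<comment> \<open>\<open>Sup\<close> is an upper bound only for a set bounded above; compactness
      supplies the bound C.\<close>
    obtain C where C: "\<And>U. U \<in> RHinf_le v \<Longrightarrow> act_dual_norm U \<le> 1 \<Longrightarrow> h2_norm (L.adj (?L U)) \<le> C"
      using M.bounded_h2_norm by blast
    have "act_dual_norm (?h (tf_scale ?c D)) \<le> \<beta>"
      unfolding \<beta>_def beta_gain_def
    proof (rule cSup_upper)
      show "act_dual_norm (?h (tf_scale ?c D))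
          \<in> {act_dual_norm (Ladj A B2 C1 t v (h2_orth (A_star Us)) (?L \<Delta>)) |\<Delta>.
              act_dual_norm \<Delta> \<le> 1 \<and> \<Delta> \<in> A_star Us \<inter> RHinf_le v}"
        using normalize[OF D False] D_star L.mem[OF RHinf_le_scale[OF Dv, of ?c]]
        by (intro CollectI exI[of _ "tf_scale ?c D"]) (auto simp: Ladj_orth)
      have "act_dual_norm (?h U) \<le> C" if U: "U \<in> RHinf_le v" "act_dual_norm U \<le> 1" for U
      proof (rule act_dual_norm_le[OF h[OF U(1)]])
        show "h2_norm (keep_rows {i} (?h U)) \<le> C" for i
          using h2_norm_keep_rows_le[OF M.mem[OF U(1)], of "{i} \<inter> - P"] C[OF U]
          by (simp add: keep_rows_keep_rows)
      qed
      then show "bdd_above {act_dual_norm (Ladj A B2 C1 t v (h2_orth (A_star Us)) (?L \<Delta>)) |\<Delta>.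
              act_dual_norm \<Delta> \<le> 1 \<and> \<Delta> \<in> A_star Us \<inter> RHinf_le v}"
        by (auto simp: Ladj_orth L.mem intro!: bdd_aboveI[of _ C])
    qed
    moreover have "?h (tf_scale ?c D) = tf_scale ?c (?h D)"
      by (simp add: M.scale[OF Dv] keep_rows_scale)
    ultimately have "?c * act_dual_norm (?h D) \<le> \<beta>"
      using normalize(3)[OF D False] by (simp add: act_dual_norm_scale[OF h[OF Dv]])
    then show ?thesis using normalize(3)[OF D False] by (simp add: field_simps)
  qed

  define a where "a = act_dual_norm (keep_rows P (L.adj (y - ?L U0))) + \<rho> * act_dual_norm U0"
  define b where "b = act_dual_norm (keep_rows (- P) (L.adj (y - ?L U0)))"
  have lam: "lam > \<delta> / (1 - \<delta>) * a + 1 / (1 - \<delta>) * b"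
    using assms(12) unfolding R Ladj_star[OF Rt] Ladj_orth[OF Rt] U0_def[symmetric] a_def b_def .
  have \<delta>: "\<delta> = \<beta> / \<alpha>" using assms(9) by (simp add: \<alpha>_def \<beta>_def)
  obtain V where V: "V \<in> fir_rows v P"
    and opt: "\<And>U. U \<in> RHinf_le v \<Longrightarrow> U \<noteq> V \<Longrightarrow> L.cost y \<rho> lam V < L.cost y \<rho> lam U"
    and dist: "\<alpha> * act_dual_norm (U0 - V) \<le> lam + a"
    using L.support_restricted_minimizer[OF y \<open>\<rho> \<ge> 0\<close> U0 \<open>0 < \<alpha>\<close> \<open>0 \<le> \<beta>\<close> \<delta> \<open>\<delta> < 1\<close>
        alpha beta a_def b_def lam] by blast
  have Vv: "V \<in> RHinf_le v" and VP: "keep_rows P V = V" using V by (auto simp: fir_rows_def)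
  have obj: "objective A B1 B2 C1 \<rho> lam t = L.cost y \<rho> lam"
    by (simp add: fun_eq_iff objective_def L.cost_def y_def)
  \<comment> \<open>A strict minimizer over all of \<open>RHinf_le v\<close> is the only minimizer
    over every subset containing it, which settles both problems at once.\<close>
  have minimizers: "minimizers (objective A B1 B2 C1 \<rho> lam t) S = {V}"
    if "V \<in> S" "S \<subseteq> RHinf_le v" for S
  proof -
    have "L.cost y \<rho> lam V < L.cost y \<rho> lam U" if "U \<in> S" "U \<noteq> V" for U
      using opt that \<open>S \<subseteq> RHinf_le v\<close> by blast
    then show ?thesis
      using \<open>V \<in> S\<close> unfolding minimizers_def is_arg_min_def obj
      by (auto intro: less_asym)
  qed
  have "row_support V \<subseteq> row_support Us"
    using VP by (auto simp: keep_rows_eq_self_iff row_support_def P_def)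
  moreover have "h2_proj S V \<noteq> 0"
    if S: "S \<in> M_star Us" and large: "h2_norm (h2_proj S U0) > 1 / \<alpha> * (lam + a)" for S
  proof
    assume "h2_proj S V = 0"
    obtain i where i: "S = act_space i" using S by (auto simp: M_star_def M_act_def)
    have "keep_rows {i} V = 0"
      using \<open>h2_proj S V = 0\<close> Vv by (simp add: i h2_proj_act_space RHinf_le_subset_RHinf)
    \<comment> \<open>Where row i of V vanishes, row i of U0 - V is that of U0, and
      \<open>dist\<close> bounds it.\<close>
    then have "h2_norm (h2_proj S U0) = h2_norm (keep_rows {i} (U0 - V))"
      using U0v by (simp add: i h2_proj_act_space RHinf_le_subset_RHinf keep_rows_diff)
    also have "\<dots> \<le> act_dual_norm (U0 - V)"
      using U0v Vv by (intro h2_norm_row_le_act_dual_norm) auto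
    also have "\<dots> \<le> 1 / \<alpha> * (lam + a)"
      using dist \<open>0 < \<alpha>\<close> by (simp add: field_simps)
    finally show False using large by simp
  qed
  ultimately show ?thesis
    using minimizers[of "fir_rows v P"] minimizers[of "RHinf_le v"] V Vv
    unfolding D_star R Ladj_star[OF Rt] U0_def[symmetric] \<alpha>_def[symmetric] a_def
    by (intro exI[of _ V]) (auto simp: fir_rows_def add.assoc)
qed

end
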